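(* Let $\mathcal{C}$ be an additive finitely accessible category with products and an additive closed symmetric monoidal structure such that $\mathcal{C}^{\mathrm{fp}}$ is a monoidal subcategory. Setting the closed subsets of $\mathrm{pinj}_{\mathcal{C}}$ to be those given by the indecomposable pure-injectives contained in an fp-hom-closed definable subcategory of $\mathcal{C}$ defines a topology on $\mathrm{pinj}_{\mathcal{C}}$. That is, the sets $\{[X]\in\mathrm{pinj}_{\mathcal{C}}: X\in\mathcal{D}\}$, as $\mathcal{D}$ runs through the fp-hom-closed definable subcategories of $\mathcal{C}$, are the closed sets of a topology.
   Context: $\mathcal{C}$ is finitely accessible if it has direct limits and a set of finitely presented objects such that every object is a direct limit of objects in this set; $\mathcal{C}^{\mathrm{fp}}$ is the full subcategory of finitely presented objects. A monomorphism $m:X\to Y$ in $\mathcal{C}$ is pure if for every $f:A\to B$ in $\mathcal{C}^{\mathrm{fp}}$ and all $h:A\to X$, $h':B\to Y$ with $h'f=mh$ there is $k:B\to X$ with $kf=h$. A full subcategory $\mathcal{D}\subseteq\mathcal{C}$ is definable if closed under products, direct limits and pure subobjects; it is fp-hom-closed if $\mathrm{hom}(A,X)\in\mathcal{D}$ for all $A\in\mathcal{C}^{\mathrm{fp}}$, $X\in\mathcal{D}$, where $\mathrm{hom}$ is the internal hom of $\mathcal{C}$. An object is pure-injective if it is injective over pure monomorphisms. $\mathrm{pinj}_{\mathcal{C}}$ is the set of isomorphism classes $[X]$ of indecomposable pure-injective objects of $\mathcal{C}$. The topology of the theorem is called the fp-hom-closed Ziegler topology and denoted $\mathrm{Zg}(\mathcal{C})^{\mathrm{hom}}$.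 *)

theory Defs
  imports "HOL-Analysis.Analysis" "HOL-Library.Equipollence" "HOL-Algebra.Group"
begin

subsection \<open>Sizes\<close>

text \<open>
  The distinction between sets and classes is made by a Grothendieck universe, represented by its
  cardinality: \<open>U\<close> has an uncountable strongly inaccessible cardinality, and a set of any
  type is small if it has strictly smaller cardinality than \<open>U\<close>. The objects of a category
  need not form a small set. As every small set is equipollent to a small subset of \<open>U\<close>,
  products and direct limits are indexed by small subsets of \<open>U\<close>.
\<close>

definition universe :: "'u set \<Rightarrow> bool" where
  "universe U \<longleftrightarrow>
     (UNIV :: nat set) \<prec> U \<and>
     (\<forall>A :: 'u set. A \<prec> U \<longrightarrow> Pow A \<prec> U) \<and>
     (\<forall>(I :: 'u set) (A :: 'u \<Rightarrow> 'u set). I \<prec> U \<and> (\<forall>i\<in>I. A i \<prec> U) \<longrightarrow> (\<Union>i\<in>I. A i) \<prec> U)"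


subsection \<open>Categories, additive categories\<close>

record ('o, 'm) ab_cat =
  Obj :: "'o set"
  Arr :: "'m set"
  Dom :: "'m \<Rightarrow> 'o"
  Cod :: "'m \<Rightarrow> 'o"
  Ide :: "'o \<Rightarrow> 'm"
  Cmp :: "'m \<Rightarrow> 'm \<Rightarrow> 'm" (infixr \<open>\<cdot>\<index>\<close> 70)
  Add :: "'m \<Rightarrow> 'm \<Rightarrow> 'm" (infixl \<open>\<oplus>\<^sub>m\<index>\<close> 65)
  Nul :: "'o \<Rightarrow> 'o \<Rightarrow> 'm"

definition Hom :: "('o, 'm, 'z) ab_cat_scheme \<Rightarrow> 'o \<Rightarrow> 'o \<Rightarrow> 'm set" where
  "Hom C a b = {f \<in> Arr C. Dom C f = a \<and> Cod C f = b}"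

definition hom_group :: "('o, 'm, 'z) ab_cat_scheme \<Rightarrow> 'o \<Rightarrow> 'o \<Rightarrow> 'm monoid" where
  "hom_group C a b = \<lparr>carrier = Hom C a b, mult = Add C, one = Nul C a b\<rparr>"

locale category =
  fixes C :: "('o, 'm, 'z) ab_cat_scheme" (structure)
  assumes Dom_closed: "f \<in> Arr C \<Longrightarrow> Dom C f \<in> Obj C"
    and Cod_closed: "f \<in> Arr C \<Longrightarrow> Cod C f \<in> Obj C"
    and Ide_closed: "a \<in> Obj C \<Longrightarrow> Ide C a \<in> Hom C a a"
    and Cmp_closed: "f \<in> Hom C a b \<Longrightarrow> g \<in> Hom C b c \<Longrightarrow> g \<cdot> f \<in> Hom C a c"
    and Ide_left: "f \<in> Hom C a b \<Longrightarrow> Ide C b \<cdot> f = f"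
    and Ide_right: "f \<in> Hom C a b \<Longrightarrow> f \<cdot> Ide C a = f"
    and Cmp_assoc: "f \<in> Hom C a b \<Longrightarrow> g \<in> Hom C b c \<Longrightarrow> h \<in> Hom C c d
        \<Longrightarrow> (h \<cdot> g) \<cdot> f = h \<cdot> (g \<cdot> f)"

locale preadditive_category = category +
  assumes hom_comm_group: "a \<in> Obj C \<Longrightarrow> b \<in> Obj C \<Longrightarrow> comm_group (hom_group C a b)"
    and Cmp_Add_left: "f \<in> Hom C a b \<Longrightarrow> g \<in> Hom C b c \<Longrightarrow> h \<in> Hom C b c
        \<Longrightarrow> (g \<oplus>\<^sub>m h) \<cdot> f = (g \<cdot> f) \<oplus>\<^sub>m (h \<cdot> f)"
    and Cmp_Add_right: "f \<in> Hom C a b \<Longrightarrow> g \<in> Hom C a b \<Longrightarrow> h \<in> Hom C b c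
        \<Longrightarrow> h \<cdot> (f \<oplus>\<^sub>m g) = (h \<cdot> f) \<oplus>\<^sub>m (h \<cdot> g)"

definition zero_object :: "('o, 'm, 'z) ab_cat_scheme \<Rightarrow> 'o \<Rightarrow> bool" where
  "zero_object C z \<longleftrightarrow> z \<in> Obj C \<and>
     (\<forall>a\<in>Obj C. (\<exists>!f. f \<in> Hom C a z) \<and> (\<exists>!f. f \<in> Hom C z a))"

definition biproduct ::
    "('o, 'm, 'z) ab_cat_scheme \<Rightarrow> 'o \<Rightarrow> 'o \<Rightarrow> 'o \<Rightarrow> 'm \<Rightarrow> 'm \<Rightarrow> 'm \<Rightarrow> 'm \<Rightarrow> bool" where
  "biproduct C a b s i\<^sub>1 i\<^sub>2 p\<^sub>1 p\<^sub>2 \<longleftrightarrow>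
     a \<in> Obj C \<and> b \<in> Obj C \<and> s \<in> Obj C \<and>
     i\<^sub>1 \<in> Hom C a s \<and> i\<^sub>2 \<in> Hom C b s \<and> p\<^sub>1 \<in> Hom C s a \<and> p\<^sub>2 \<in> Hom C s b \<and>
     p\<^sub>1 \<cdot>\<^bsub>C\<^esub> i\<^sub>1 = Ide C a \<and> p\<^sub>2 \<cdot>\<^bsub>C\<^esub> i\<^sub>2 = Ide C b \<and>
     p\<^sub>2 \<cdot>\<^bsub>C\<^esub> i\<^sub>1 = Nul C a b \<and> p\<^sub>1 \<cdot>\<^bsub>C\<^esub> i\<^sub>2 = Nul C b a \<and>
     (i\<^sub>1 \<cdot>\<^bsub>C\<^esub> p\<^sub>1) \<oplus>\<^sub>m\<^bsub>C\<^esub> (i\<^sub>2 \<cdot>\<^bsub>C\<^esub> p\<^sub>2) = Ide C s"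

locale additive_category = preadditive_category +
  assumes zero_object_exists: "\<exists>z. zero_object C z"
    and biproduct_exists: "a \<in> Obj C \<Longrightarrow> b \<in> Obj C
        \<Longrightarrow> \<exists>s i\<^sub>1 i\<^sub>2 p\<^sub>1 p\<^sub>2. biproduct C a b s i\<^sub>1 i\<^sub>2 p\<^sub>1 p\<^sub>2"

definition iso_arr :: "('o, 'm, 'z) ab_cat_scheme \<Rightarrow> 'o \<Rightarrow> 'o \<Rightarrow> 'm \<Rightarrow> bool" where
  "iso_arr C a b f \<longleftrightarrow> f \<in> Hom C a b \<and>
     (\<exists>g\<in>Hom C b a. g \<cdot>\<^bsub>C\<^esub> f = Ide C a \<and> f \<cdot>\<^bsub>C\<^esub> g = Ide C b)"

definition iso_class :: "('o, 'm, 'z) ab_cat_scheme \<Rightarrow> 'o \<Rightarrow> 'o set" where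
  "iso_class C X = {Y \<in> Obj C. \<exists>f. iso_arr C X Y f}"

definition mono_arr :: "('o, 'm, 'z) ab_cat_scheme \<Rightarrow> 'o \<Rightarrow> 'o \<Rightarrow> 'm \<Rightarrow> bool" where
  "mono_arr C X Y m \<longleftrightarrow> m \<in> Hom C X Y \<and>
     (\<forall>a\<in>Obj C. \<forall>f\<in>Hom C a X. \<forall>g\<in>Hom C a X. m \<cdot>\<^bsub>C\<^esub> f = m \<cdot>\<^bsub>C\<^esub> g \<longrightarrow> f = g)"

definition indecomposable :: "('o, 'm, 'z) ab_cat_scheme \<Rightarrow> 'o \<Rightarrow> bool" where
  "indecomposable C X \<longleftrightarrow> X \<in> Obj C \<and> \<not> zero_object C X \<and>
     (\<forall>a b i\<^sub>1 i\<^sub>2 p\<^sub>1 p\<^sub>2. biproduct C a b X i\<^sub>1 i\<^sub>2 p\<^sub>1 p\<^sub>2 \<longrightarrow> zero_object C a \<or> zero_object C b)"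


subsection \<open>Products and direct limits\<close>

definition product_cone ::
    "('o, 'm, 'z) ab_cat_scheme \<Rightarrow> 'u set \<Rightarrow> ('u \<Rightarrow> 'o) \<Rightarrow> 'o \<Rightarrow> ('u \<Rightarrow> 'm) \<Rightarrow> bool" where
  "product_cone C I X P p \<longleftrightarrow>
     (\<forall>i\<in>I. X i \<in> Obj C) \<and> P \<in> Obj C \<and> (\<forall>i\<in>I. p i \<in> Hom C P (X i)) \<and>
     (\<forall>Q q. Q \<in> Obj C \<and> (\<forall>i\<in>I. q i \<in> Hom C Q (X i)) \<longrightarrow>
        (\<exists>!u. u \<in> Hom C Q P \<and> (\<forall>i\<in>I. p i \<cdot>\<^bsub>C\<^esub> u = q i)))"

definition has_products :: "'u set \<Rightarrow> ('o, 'm, 'z) ab_cat_scheme \<Rightarrow> bool" where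
  "has_products U C \<longleftrightarrow>
     (\<forall>I X. I \<subseteq> U \<and> I \<prec> U \<and> (\<forall>i\<in>I. X i \<in> Obj C) \<longrightarrow> (\<exists>P p. product_cone C I X P p))"

definition directed_index :: "'u set \<Rightarrow> 'u set \<Rightarrow> 'u rel \<Rightarrow> bool" where
  "directed_index U I r \<longleftrightarrow> I \<subseteq> U \<and> I \<prec> U \<and> I \<noteq> {} \<and> partial_order_on I r \<and>
     (\<forall>i\<in>I. \<forall>j\<in>I. \<exists>k\<in>I. (i, k) \<in> r \<and> (j, k) \<in> r)"

definition direct_system ::
    "('o, 'm, 'z) ab_cat_scheme \<Rightarrow> 'u set \<Rightarrow> 'u rel \<Rightarrow> ('u \<Rightarrow> 'o) \<Rightarrow> ('u \<Rightarrow> 'u \<Rightarrow> 'm) \<Rightarrow> bool" where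
  "direct_system C I r X \<phi> \<longleftrightarrow>
     (\<forall>i\<in>I. X i \<in> Obj C) \<and>
     (\<forall>(i, j)\<in>r. \<phi> i j \<in> Hom C (X i) (X j)) \<and>
     (\<forall>i\<in>I. \<phi> i i = Ide C (X i)) \<and>
     (\<forall>i j k. (i, j) \<in> r \<and> (j, k) \<in> r \<longrightarrow> \<phi> j k \<cdot>\<^bsub>C\<^esub> \<phi> i j = \<phi> i k)"

definition cocone ::
    "('o, 'm, 'z) ab_cat_scheme \<Rightarrow> 'u set \<Rightarrow> 'u rel \<Rightarrow> ('u \<Rightarrow> 'o) \<Rightarrow> ('u \<Rightarrow> 'u \<Rightarrow> 'm)
      \<Rightarrow> 'o \<Rightarrow> ('u \<Rightarrow> 'm) \<Rightarrow> bool" where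
  "cocone C I r X \<phi> L l \<longleftrightarrow> L \<in> Obj C \<and> (\<forall>i\<in>I. l i \<in> Hom C (X i) L) \<and>
     (\<forall>(i, j)\<in>r. l j \<cdot>\<^bsub>C\<^esub> \<phi> i j = l i)"

definition direct_limit ::
    "('o, 'm, 'z) ab_cat_scheme \<Rightarrow> 'u set \<Rightarrow> 'u rel \<Rightarrow> ('u \<Rightarrow> 'o) \<Rightarrow> ('u \<Rightarrow> 'u \<Rightarrow> 'm)
      \<Rightarrow> 'o \<Rightarrow> ('u \<Rightarrow> 'm) \<Rightarrow> bool" where
  "direct_limit C I r X \<phi> L l \<longleftrightarrow> cocone C I r X \<phi> L l \<and>
     (\<forall>M m. cocone C I r X \<phi> M m \<longrightarrow>
        (\<exists>!u. u \<in> Hom C L M \<and> (\<forall>i\<in>I. u \<cdot>\<^bsub>C\<^esub> l i = m i)))"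

definition has_direct_limits :: "'u set \<Rightarrow> ('o, 'm, 'z) ab_cat_scheme \<Rightarrow> bool" where
  "has_direct_limits U C \<longleftrightarrow>
     (\<forall>I r X \<phi>. directed_index U I r \<and> direct_system C I r X \<phi> \<longrightarrow>
        (\<exists>L l. direct_limit C I r X \<phi> L l))"


subsection \<open>Finitely presented objects and finite accessibility\<close>

text \<open>
  An object \<open>A\<close> is finitely presented if \<open>Hom(A, -)\<close> commutes with direct limits. The
  direct limit of the sets \<open>Hom(A, X i)\<close> is constructed as the usual quotient of their
  disjoint union.
\<close>

definition hom_dirlim ::
    "('o, 'm, 'z) ab_cat_scheme \<Rightarrow> 'o \<Rightarrow> 'u set \<Rightarrow> 'u rel \<Rightarrow> ('u \<Rightarrow> 'o) \<Rightarrow> ('u \<Rightarrow> 'u \<Rightarrow> 'm)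
      \<Rightarrow> ('u \<times> 'm) set set" where
  "hom_dirlim C A I r X \<phi> =
     (SIGMA i:I. Hom C A (X i)) //
       {((i, f), (j, g)). i \<in> I \<and> f \<in> Hom C A (X i) \<and> j \<in> I \<and> g \<in> Hom C A (X j) \<and>
          (\<exists>k\<in>I. (i, k) \<in> r \<and> (j, k) \<in> r \<and> \<phi> i k \<cdot>\<^bsub>C\<^esub> f = \<phi> j k \<cdot>\<^bsub>C\<^esub> g)}"

text \<open>The canonical map to \<open>Hom(A, L)\<close> sends the class of \<open>(i, f)\<close> to \<open>l i \<cdot> f\<close>.\<close>

definition hom_dirlim_map ::
    "('o, 'm, 'z) ab_cat_scheme \<Rightarrow> ('u \<Rightarrow> 'm) \<Rightarrow> ('u \<times> 'm) set \<Rightarrow> 'm" where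
  "hom_dirlim_map C l c = the_elem ((\<lambda>(i, f). l i \<cdot>\<^bsub>C\<^esub> f) ` c)"

definition finitely_presented :: "'u set \<Rightarrow> ('o, 'm, 'z) ab_cat_scheme \<Rightarrow> 'o \<Rightarrow> bool" where
  "finitely_presented U C A \<longleftrightarrow> A \<in> Obj C \<and>
     (\<forall>I r X \<phi> L l. directed_index U I r \<and> direct_system C I r X \<phi> \<and> direct_limit C I r X \<phi> L l
        \<longrightarrow> bij_betw (hom_dirlim_map C l) (hom_dirlim C A I r X \<phi>) (Hom C A L))"

definition finitely_accessible :: "'u set \<Rightarrow> ('o, 'm, 'z) ab_cat_scheme \<Rightarrow> bool" where
  "finitely_accessible U C \<longleftrightarrow>
     (\<forall>a\<in>Obj C. \<forall>b\<in>Obj C. Hom C a b \<prec> U) \<and>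
     has_direct_limits U C \<and>
     (\<exists>G. G \<prec> U \<and> (\<forall>A\<in>G. finitely_presented U C A) \<and>
        (\<forall>L\<in>Obj C. \<exists>I r X \<phi> l. directed_index U I r \<and> direct_system C I r X \<phi> \<and>
           (\<forall>i\<in>I. X i \<in> G) \<and> direct_limit C I r X \<phi> L l))"


subsection \<open>Purity and definable subcategories\<close>

definition pure_mono :: "'u set \<Rightarrow> ('o, 'm, 'z) ab_cat_scheme \<Rightarrow> 'o \<Rightarrow> 'o \<Rightarrow> 'm \<Rightarrow> bool" where
  "pure_mono U C X Y m \<longleftrightarrow> X \<in> Obj C \<and> Y \<in> Obj C \<and> mono_arr C X Y m \<and>
     (\<forall>A B f h h'. finitely_presented U C A \<and> finitely_presented U C B \<and>
        f \<in> Hom C A B \<and> h \<in> Hom C A X \<and> h' \<in> Hom C B Y \<and> h' \<cdot>\<^bsub>C\<^esub> f = m \<cdot>\<^bsub>C\<^esub> h \<longrightarrow>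
        (\<exists>k\<in>Hom C B X. k \<cdot>\<^bsub>C\<^esub> f = h))"

definition pure_injective :: "'u set \<Rightarrow> ('o, 'm, 'z) ab_cat_scheme \<Rightarrow> 'o \<Rightarrow> bool" where
  "pure_injective U C E \<longleftrightarrow> E \<in> Obj C \<and>
     (\<forall>X Y m f. pure_mono U C X Y m \<and> f \<in> Hom C X E \<longrightarrow> (\<exists>g\<in>Hom C Y E. g \<cdot>\<^bsub>C\<^esub> m = f))"

text \<open>
  A full subcategory is given by its set of objects. Being closed under pure subobjects, a
  definable subcategory is closed under isomorphisms.
\<close>

definition definable :: "'u set \<Rightarrow> ('o, 'm, 'z) ab_cat_scheme \<Rightarrow> 'o set \<Rightarrow> bool" where
  "definable U C D \<longleftrightarrow> D \<subseteq> Obj C \<and>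
     (\<forall>I X P p. I \<subseteq> U \<and> I \<prec> U \<and> (\<forall>i\<in>I. X i \<in> D) \<and> product_cone C I X P p \<longrightarrow> P \<in> D) \<and>
     (\<forall>I r X \<phi> L l. directed_index U I r \<and> direct_system C I r X \<phi> \<and> (\<forall>i\<in>I. X i \<in> D) \<and>
        direct_limit C I r X \<phi> L l \<longrightarrow> L \<in> D) \<and>
     (\<forall>X Y m. pure_mono U C X Y m \<and> Y \<in> D \<longrightarrow> X \<in> D)"

definition indec_pinj :: "'u set \<Rightarrow> ('o, 'm, 'z) ab_cat_scheme \<Rightarrow> 'o \<Rightarrow> bool" where
  "indec_pinj U C X \<longleftrightarrow> indecomposable C X \<and> pure_injective U C X"

definition pinj :: "'u set \<Rightarrow> ('o, 'm, 'z) ab_cat_scheme \<Rightarrow> 'o set set" where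
  "pinj U C = {iso_class C X | X. indec_pinj U C X}"

definition pinj_in :: "'u set \<Rightarrow> ('o, 'm, 'z) ab_cat_scheme \<Rightarrow> 'o set \<Rightarrow> 'o set set" where
  "pinj_in U C D = {iso_class C X | X. indec_pinj U C X \<and> X \<in> D}"


subsection \<open>Closed symmetric monoidal structures\<close>

record ('o, 'm) csm_cat = "('o, 'm) ab_cat" +
  Unit :: "'o"
  Tob :: "'o \<Rightarrow> 'o \<Rightarrow> 'o" (infixr \<open>\<otimes>\<^sub>o\<index>\<close> 75)
  Tar :: "'m \<Rightarrow> 'm \<Rightarrow> 'm" (infixr \<open>\<otimes>\<^sub>a\<index>\<close> 75)
  Assoc :: "'o \<Rightarrow> 'o \<Rightarrow> 'o \<Rightarrow> 'm"
  LUnit :: "'o \<Rightarrow> 'm"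
  RUnit :: "'o \<Rightarrow> 'm"
  Braid :: "'o \<Rightarrow> 'o \<Rightarrow> 'm"
  IHom :: "'o \<Rightarrow> 'o \<Rightarrow> 'o"
  Ev :: "'o \<Rightarrow> 'o \<Rightarrow> 'm"

locale symmetric_monoidal_category = category C
  for C :: "('o, 'm, 'z) csm_cat_scheme" (structure) +
  assumes Unit_closed: "Unit C \<in> Obj C"
    and Tob_closed: "a \<in> Obj C \<Longrightarrow> b \<in> Obj C \<Longrightarrow> a \<otimes>\<^sub>o b \<in> Obj C"
    and Tar_closed: "f \<in> Hom C a a' \<Longrightarrow> g \<in> Hom C b b'
        \<Longrightarrow> f \<otimes>\<^sub>a g \<in> Hom C (a \<otimes>\<^sub>o b) (a' \<otimes>\<^sub>o b')"
    and Tar_Ide: "a \<in> Obj C \<Longrightarrow> b \<in> Obj C \<Longrightarrow> Ide C a \<otimes>\<^sub>a Ide C b = Ide C (a \<otimes>\<^sub>o b)"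
    and Tar_Cmp: "f \<in> Hom C a a' \<Longrightarrow> f' \<in> Hom C a' a'' \<Longrightarrow> g \<in> Hom C b b' \<Longrightarrow> g' \<in> Hom C b' b''
        \<Longrightarrow> (f' \<cdot> f) \<otimes>\<^sub>a (g' \<cdot> g) = (f' \<otimes>\<^sub>a g') \<cdot> (f \<otimes>\<^sub>a g)"
    and Assoc_iso: "a \<in> Obj C \<Longrightarrow> b \<in> Obj C \<Longrightarrow> c \<in> Obj C
        \<Longrightarrow> iso_arr C ((a \<otimes>\<^sub>o b) \<otimes>\<^sub>o c) (a \<otimes>\<^sub>o (b \<otimes>\<^sub>o c)) (Assoc C a b c)"
    and Assoc_natural: "f \<in> Hom C a a' \<Longrightarrow> g \<in> Hom C b b' \<Longrightarrow> h \<in> Hom C c c'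
        \<Longrightarrow> Assoc C a' b' c' \<cdot> ((f \<otimes>\<^sub>a g) \<otimes>\<^sub>a h) = (f \<otimes>\<^sub>a (g \<otimes>\<^sub>a h)) \<cdot> Assoc C a b c"
    and LUnit_iso: "a \<in> Obj C \<Longrightarrow> iso_arr C (Unit C \<otimes>\<^sub>o a) a (LUnit C a)"
    and LUnit_natural: "f \<in> Hom C a b \<Longrightarrow> LUnit C b \<cdot> (Ide C (Unit C) \<otimes>\<^sub>a f) = f \<cdot> LUnit C a"
    and RUnit_iso: "a \<in> Obj C \<Longrightarrow> iso_arr C (a \<otimes>\<^sub>o Unit C) a (RUnit C a)"
    and RUnit_natural: "f \<in> Hom C a b \<Longrightarrow> RUnit C b \<cdot> (f \<otimes>\<^sub>a Ide C (Unit C)) = f \<cdot> RUnit C a"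
    and pentagon: "a \<in> Obj C \<Longrightarrow> b \<in> Obj C \<Longrightarrow> c \<in> Obj C \<Longrightarrow> d \<in> Obj C
        \<Longrightarrow> Assoc C a b (c \<otimes>\<^sub>o d) \<cdot> Assoc C (a \<otimes>\<^sub>o b) c d =
            (Ide C a \<otimes>\<^sub>a Assoc C b c d) \<cdot> Assoc C a (b \<otimes>\<^sub>o c) d \<cdot> (Assoc C a b c \<otimes>\<^sub>a Ide C d)"
    and triangle: "a \<in> Obj C \<Longrightarrow> b \<in> Obj C
        \<Longrightarrow> (Ide C a \<otimes>\<^sub>a LUnit C b) \<cdot> Assoc C a (Unit C) b = RUnit C a \<otimes>\<^sub>a Ide C b"
    and Braid_closed: "a \<in> Obj C \<Longrightarrow> b \<in> Obj C \<Longrightarrow> Braid C a b \<in> Hom C (a \<otimes>\<^sub>o b) (b \<otimes>\<^sub>o a)"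
    and Braid_natural: "f \<in> Hom C a a' \<Longrightarrow> g \<in> Hom C b b'
        \<Longrightarrow> Braid C a' b' \<cdot> (f \<otimes>\<^sub>a g) = (g \<otimes>\<^sub>a f) \<cdot> Braid C a b"
    and symmetry: "a \<in> Obj C \<Longrightarrow> b \<in> Obj C \<Longrightarrow> Braid C b a \<cdot> Braid C a b = Ide C (a \<otimes>\<^sub>o b)"
    and hexagon: "a \<in> Obj C \<Longrightarrow> b \<in> Obj C \<Longrightarrow> c \<in> Obj C
        \<Longrightarrow> Assoc C b c a \<cdot> Braid C a (b \<otimes>\<^sub>o c) \<cdot> Assoc C a b c =
            (Ide C b \<otimes>\<^sub>a Braid C a c) \<cdot> Assoc C b a c \<cdot> (Braid C a b \<otimes>\<^sub>a Ide C c)"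

text \<open>
  Closedness: \<open>IHom C a -\<close> is right adjoint to \<open>- \<otimes> a\<close>, with counit \<open>Ev C a\<close>, expressed by
  universal arrows.
\<close>

locale closed_symmetric_monoidal_category = symmetric_monoidal_category +
  assumes IHom_closed: "a \<in> Obj C \<Longrightarrow> b \<in> Obj C \<Longrightarrow> IHom C a b \<in> Obj C"
    and Ev_closed: "a \<in> Obj C \<Longrightarrow> b \<in> Obj C \<Longrightarrow> Ev C a b \<in> Hom C (IHom C a b \<otimes>\<^sub>o a) b"
    and Ev_universal: "a \<in> Obj C \<Longrightarrow> b \<in> Obj C \<Longrightarrow> x \<in> Obj C \<Longrightarrow> f \<in> Hom C (x \<otimes>\<^sub>o a) b
        \<Longrightarrow> \<exists>!g. g \<in> Hom C x (IHom C a b) \<and> Ev C a b \<cdot> (g \<otimes>\<^sub>a Ide C a) = f"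

locale additive_closed_symmetric_monoidal_category =
  additive_category C + closed_symmetric_monoidal_category C
  for C :: "('o, 'm, 'z) csm_cat_scheme" (structure) +
  assumes Tar_Add_left: "f \<in> Hom C a a' \<Longrightarrow> g \<in> Hom C a a' \<Longrightarrow> h \<in> Hom C b b'
        \<Longrightarrow> (f \<oplus>\<^sub>m g) \<otimes>\<^sub>a h = (f \<otimes>\<^sub>a h) \<oplus>\<^sub>m (g \<otimes>\<^sub>a h)"
    and Tar_Add_right: "f \<in> Hom C a a' \<Longrightarrow> g \<in> Hom C b b' \<Longrightarrow> h \<in> Hom C b b'
        \<Longrightarrow> f \<otimes>\<^sub>a (g \<oplus>\<^sub>m h) = (f \<otimes>\<^sub>a g) \<oplus>\<^sub>m (f \<otimes>\<^sub>a h)"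

text \<open>As finitely presented objects form a full subcategory, only objects need to be considered.\<close>

definition fp_monoidal_subcategory :: "'u set \<Rightarrow> ('o, 'm, 'z) csm_cat_scheme \<Rightarrow> bool" where
  "fp_monoidal_subcategory U C \<longleftrightarrow> finitely_presented U C (Unit C) \<and>
     (\<forall>A B. finitely_presented U C A \<and> finitely_presented U C B \<longrightarrow>
        finitely_presented U C (A \<otimes>\<^sub>o\<^bsub>C\<^esub> B))"

definition fp_hom_closed :: "'u set \<Rightarrow> ('o, 'm, 'z) csm_cat_scheme \<Rightarrow> 'o set \<Rightarrow> bool" where
  "fp_hom_closed U C D \<longleftrightarrow>
     (\<forall>A X. finitely_presented U C A \<and> X \<in> D \<longrightarrow> IHom C A X \<in> D)"

end

theory Submission
  imports Defs
begin

text \<open>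
  Intersections of fp-hom-closed definable subcategories are again of this kind, and the zero objects
  form one that contains no indecomposable object; so the content of the theorem is that the
  proposed closed sets are stable under binary unions.

  Fix definable subcategories \<open>D1\<close> and \<open>D2\<close>. A map \<open>h : A \<rightarrow> X\<close> may or may not factor through a map
  \<open>f : A \<rightarrow> B\<close>, where \<open>A\<close> and \<open>B\<close> are finitely presented. The join of \<open>D1\<close> and \<open>D2\<close> consists of the
  objects \<open>X\<close> for which every failure of such a factorization remains visible after composing with
  some map from \<open>X\<close> to an object of \<open>D1\<close> or \<open>D2\<close>. Products and pure subobjects cause no difficulty. In
  a direct limit \<open>L\<close> of objects of the join, a failure for \<open>h : A \<rightarrow> L\<close> comes from failures at all late
  stages; one of the two subcategories detects them cofinally often, and the reduced product of
  the detecting objects along these stages belongs to that subcategory and detects the failure in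
  \<open>L\<close>. Finally, if \<open>D1\<close> and \<open>D2\<close> are fp-hom-closed then so is the join: by adjunction, \<open>A \<rightarrow> hom(P, X)\<close>
  factors through \<open>f\<close> if and only if \<open>A \<otimes> P \<rightarrow> X\<close> factors through \<open>f \<otimes> P\<close>, and tensor products of
  finitely presented objects are finitely presented.

  Let \<open>X\<close> be an indecomposable pure-injective object in the join. There is only a small set of pairs
  \<open>(f, h)\<close> to be considered, so a product of detecting maps yields single maps \<open>X \<rightarrow> Z1\<close> and
  \<open>X \<rightarrow> Z2\<close>, with \<open>Zi\<close> in \<open>Di\<close>, which see all that maps to \<open>D1\<close> or \<open>D2\<close> can see. Then
  \<open>X \<rightarrow> Z1 \<oplus> Z2\<close> is a pure monomorphism, and it splits. So \<open>1 = a + b\<close> in the endomorphism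
  ring of \<open>X\<close>, where \<open>a\<close> factors through \<open>Z1\<close> and \<open>b\<close> through \<open>Z2\<close>. The endomorphism ring has the
  exchange property (lemma \<open>pure_injective_exchange\<close>): some idempotent \<open>e\<close> is a left multiple of \<open>a\<close>
  while \<open>1 - e\<close> is a left multiple of \<open>b\<close>. Idempotents split, so \<open>e\<close> is \<open>0\<close> or \<open>1\<close>, and \<open>X\<close> is a direct
  summand of \<open>Z2\<close> or of \<open>Z1\<close>. Hence the join contains no indecomposable pure-injective objects
  beyond those of \<open>D1\<close> and \<open>D2\<close>.

  Reduced products also give the exchange property. The diagonal of a pure-injective object \<open>X\<close>
  in a reduced power of \<open>X\<close> is pure, so it has a retraction, and this assigns to a family of
  endomorphisms of \<open>X\<close> a limit that commutes with composition on the right. These limits provide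
  the upper bounds that an application of Zorn's lemma requires.
\<close>

section \<open>Preadditive categories\<close>

lemma HomD:
  assumes "f \<in> Hom C a b"
  shows "f \<in> Arr C" "Dom C f = a" "Cod C f = b"
  using assms unfolding Hom_def by auto

context category
begin

lemma Hom_Obj:
  assumes "f \<in> Hom C a b"
  shows "a \<in> Obj C" "b \<in> Obj C"
  using assms Dom_closed Cod_closed unfolding Hom_def by auto

end

context preadditive_category
begin

lemma Nul_closed: "a \<in> Obj C \<Longrightarrow> b \<in> Obj C \<Longrightarrow> Nul C a b \<in> Hom C a b"
  using comm_group.axioms(2)[OF hom_comm_group] monoid.one_closed[OF group.is_monoid]
  unfolding hom_group_def by fastforce

lemma Add_closed:
  assumes "f \<in> Hom C a b" "g \<in> Hom C a b"
  shows "f \<oplus>\<^sub>m g \<in> Hom C a b"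
proof -
  interpret comm_group "hom_group C a b" using hom_comm_group Hom_Obj[OF assms(1)] by blast
  show ?thesis using m_closed assms unfolding hom_group_def by simp
qed

lemma Add_Nul:
  assumes "f \<in> Hom C a b"
  shows "f \<oplus>\<^sub>m Nul C a b = f" "Nul C a b \<oplus>\<^sub>m f = f"
proof -
  interpret comm_group "hom_group C a b" using hom_comm_group Hom_Obj[OF assms(1)] by blast
  show "f \<oplus>\<^sub>m Nul C a b = f" "Nul C a b \<oplus>\<^sub>m f = f"
    using r_one l_one assms unfolding hom_group_def by simp_all
qed

lemma Add_assoc:
  assumes "f \<in> Hom C a b" "g \<in> Hom C a b" "h \<in> Hom C a b"
  shows "(f \<oplus>\<^sub>m g) \<oplus>\<^sub>m h = f \<oplus>\<^sub>m (g \<oplus>\<^sub>m h)"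
proof -
  interpret comm_group "hom_group C a b" using hom_comm_group Hom_Obj[OF assms(1)] by blast
  show ?thesis using m_assoc assms unfolding hom_group_def by simp
qed

lemma Add_left_cancel:
  assumes "f \<in> Hom C a b" "g \<in> Hom C a b" "h \<in> Hom C a b"
  shows "f \<oplus>\<^sub>m g = f \<oplus>\<^sub>m h \<longleftrightarrow> g = h"
proof -
  interpret comm_group "hom_group C a b" using hom_comm_group Hom_Obj[OF assms(1)] by blast
  show ?thesis using Units_l_cancel[of f g h] assms unfolding Units_eq by (simp add: hom_group_def)
qed

lemma Add_inverse:
  assumes "f \<in> Hom C a b"
  shows "\<exists>g \<in> Hom C a b. f \<oplus>\<^sub>m g = Nul C a b"
proof -
  interpret comm_group "hom_group C a b" using hom_comm_group Hom_Obj[OF assms(1)] by blast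
  show ?thesis using r_inv_ex[of f] assms unfolding hom_group_def by auto
qed

lemma Add_complement:
  assumes "f \<in> Hom C a b" "h \<in> Hom C a b"
  shows "\<exists>g \<in> Hom C a b. f \<oplus>\<^sub>m g = h"
proof -
  obtain g where g: "g \<in> Hom C a b" "f \<oplus>\<^sub>m g = Nul C a b" using Add_inverse[OF assms(1)] by blast
  have "f \<oplus>\<^sub>m (g \<oplus>\<^sub>m h) = h" using Add_assoc[OF assms(1) g(1) assms(2)] g Add_Nul(2)[OF assms(2)] by simp
  then show ?thesis using Add_closed[OF g(1) assms(2)] by blast
qed

lemma Cmp_Nul_right:
  assumes "g \<in> Hom C b c" "a \<in> Obj C"
  shows "g \<cdot> Nul C a b = Nul C a c"
proof -
  have n: "Nul C a b \<in> Hom C a b" using Nul_closed assms Hom_Obj by blast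
  have gn: "g \<cdot> Nul C a b \<in> Hom C a c" using Cmp_closed[OF n assms(1)] .
  have "g \<cdot> Nul C a b \<oplus>\<^sub>m g \<cdot> Nul C a b = g \<cdot> Nul C a b \<oplus>\<^sub>m Nul C a c"
    using Cmp_Add_right[OF n n assms(1)] Add_Nul[OF n] Add_Nul[OF gn] by simp
  then show ?thesis using Add_left_cancel[OF gn gn] Nul_closed Hom_Obj[OF gn] by blast
qed

lemma Cmp_Nul_left:
  assumes "f \<in> Hom C a b" "c \<in> Obj C"
  shows "Nul C b c \<cdot> f = Nul C a c"
proof -
  have n: "Nul C b c \<in> Hom C b c" using Nul_closed assms Hom_Obj by blast
  have gn: "Nul C b c \<cdot> f \<in> Hom C a c" using Cmp_closed[OF assms(1) n] .
  have "Nul C b c \<cdot> f \<oplus>\<^sub>m Nul C b c \<cdot> f = Nul C b c \<cdot> f \<oplus>\<^sub>m Nul C a c"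
    using Cmp_Add_left[OF assms(1) n n] Add_Nul[OF n] Add_Nul[OF gn] by simp
  then show ?thesis using Add_left_cancel[OF gn gn] Nul_closed Hom_Obj[OF gn] by blast
qed

text \<open>
  In this form the property of being a zero object is inherited from the components of a product,
  a direct limit or a monomorphism.
\<close>

lemma zero_object_iff:
  assumes z: "z \<in> Obj C"
  shows "zero_object C z \<longleftrightarrow> Ide C z = Nul C z z"
proof
  assume "zero_object C z"
  then show "Ide C z = Nul C z z"
    using z Ide_closed[OF z] Nul_closed[OF z z] unfolding zero_object_def by blast
next
  assume e: "Ide C z = Nul C z z"
  show "zero_object C z" unfolding zero_object_def
  proof (intro conjI ballI z)
    fix a assume a: "a \<in> Obj C"
    have "f = Nul C a z" if "f \<in> Hom C a z" for f
      using Ide_left[OF that] Cmp_Nul_left[OF that z] e by simp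
    then show "\<exists>!f. f \<in> Hom C a z" using Nul_closed[OF a z] by blast
    have "f = Nul C z a" if "f \<in> Hom C z a" for f
      using Ide_right[OF that] Cmp_Nul_right[OF that z] e by simp
    then show "\<exists>!f. f \<in> Hom C z a" using Nul_closed[OF z a] by blast
  qed
qed

end

section \<open>Small sets\<close>

lemma universe_infinite: "universe U \<Longrightarrow> infinite U"
  unfolding universe_def using infinite_le_lepoll lesspoll_imp_lepoll by blast

lemma universe_times_lepoll:
  fixes U :: "'u set"
  assumes "universe U"
  shows "U \<times> U \<lesssim> U"
  using card_of_Times_same_infinite[OF universe_infinite[OF assms]] eqpoll_iff_card_of_ordIso
    eqpoll_imp_lepoll by blast

text \<open>
  The union axiom of a universe only speaks of subsets of \<open>U\<close>. The fibres are made disjoint inside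
  \<open>U\<close> by a pairing function, which exists because \<open>U\<close> is infinite.
\<close>

lemma small_Sigma:
  fixes U :: "'u set"
  assumes U: "universe U" and J: "J \<prec> U" and A: "\<And>j. j \<in> J \<Longrightarrow> A j \<prec> U"
  shows "Sigma J A \<prec> U"
proof -
  obtain p where p: "inj_on p (U \<times> U)" "p ` (U \<times> U) \<subseteq> U"
    using universe_times_lepoll[OF U] unfolding lepoll_def by blast
  obtain e where e: "inj_on e J" "e ` J \<subseteq> U"
    using J lesspoll_imp_lepoll unfolding lepoll_def by blast
  have "\<forall>j\<in>J. \<exists>f. inj_on f (A j) \<and> f ` A j \<subseteq> U"
    using A lesspoll_imp_lepoll unfolding lepoll_def by blast
  then obtain f where f: "\<And>j. j \<in> J \<Longrightarrow> inj_on (f j) (A j)" "\<And>j. j \<in> J \<Longrightarrow> f j ` A j \<subseteq> U" by metis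
  define d where "d x = inv_into J e x" for x
  have d: "d (e j) = j" if "j \<in> J" for j unfolding d_def using e that by simp
  define B where "B x = (\<lambda>y. p (x, f (d x) y)) ` A (d x)" for x
  have "B x \<prec> U" if x: "x \<in> e ` J" for x
  proof -
    obtain j where "j \<in> J" "x = e j" using x by blast
    then show ?thesis using A[of j] d image_lepoll[of _ "A j"] lesspoll_trans1 unfolding B_def by metis
  qed
  moreover have "e ` J \<prec> U" using J lesspoll_trans1[OF image_lepoll] by blast
  ultimately have small: "(\<Union>x\<in>e ` J. B x) \<prec> U" using U unfolding universe_def by blast
  have "Sigma J A \<lesssim> (\<Union>x\<in>e ` J. B x)"
  proof -
    have "inj_on (\<lambda>(j, y). p (e j, f j y)) (Sigma J A)"
    proof (intro inj_onI, clarify)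
      fix j y j' y'
      assume *: "j \<in> J" "y \<in> A j" "j' \<in> J" "y' \<in> A j'" "p (e j, f j y) = p (e j', f j' y')"
      then have "e j = e j'" "f j y = f j' y'"
        using inj_onD[OF p(1) *(5)] e f by (simp_all add: image_subset_iff)
      moreover then have "j = j'" using inj_onD[OF e(1)] * by blast
      ultimately show "j = j' \<and> y = y'" using inj_onD[OF f(1)] * by blast
    qed
    moreover have "(\<lambda>(j, y). p (e j, f j y)) ` Sigma J A \<subseteq> (\<Union>x\<in>e ` J. B x)"
      unfolding B_def using d by auto
    ultimately show ?thesis unfolding lepoll_def by blast
  qed
  then show ?thesis using small lesspoll_trans1 by blast
qed

lemma small_times:
  fixes U :: "'u set"
  assumes "universe U" "A \<prec> U" "B \<prec> U"
  shows "A \<times> B \<prec> U"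
  using small_Sigma[OF assms(1,2), of "\<lambda>_. B"] assms(3) by simp

text \<open>Replacing a small set by a copy inside \<open>U\<close> makes it usable as an index set.\<close>

lemma small_copy:
  assumes "A \<prec> U"
  obtains e where "inj_on e A" "e ` A \<subseteq> U" "e ` A \<prec> U"
  using assms lesspoll_imp_lepoll lesspoll_trans1[OF image_lepoll] unfolding lepoll_def by metis

lemma small_subset: "A \<prec> U \<Longrightarrow> B \<subseteq> A \<Longrightarrow> B \<prec> U"
  using subset_imp_lepoll lesspoll_trans1 by blast

section \<open>Maps from finitely presented objects\<close>

text \<open>
  For fixed \<open>f : A \<rightarrow> B\<close>, the maps \<open>h : A \<rightarrow> X\<close> with this property form the subgroup of \<open>Hom(A, X)\<close> defined
  by a positive primitive formula; purity and definability are statements about such subgroups.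
\<close>

definition factors :: "('o, 'm, 'z) ab_cat_scheme \<Rightarrow> 'm \<Rightarrow> 'm \<Rightarrow> bool" where
  "factors C f h \<longleftrightarrow> (\<exists>k\<in>Hom C (Cod C f) (Cod C h). k \<cdot>\<^bsub>C\<^esub> f = h)"

lemma directed_indexD:
  assumes "directed_index U I r"
  shows "I \<subseteq> U" "I \<prec> U" "I \<noteq> {}" "r \<subseteq> I \<times> I" "\<And>i. i \<in> I \<Longrightarrow> (i, i) \<in> r"
    "\<And>i j k. (i, j) \<in> r \<Longrightarrow> (j, k) \<in> r \<Longrightarrow> (i, k) \<in> r"
    "\<And>i j. (i, j) \<in> r \<Longrightarrow> (j, i) \<in> r \<Longrightarrow> i = j"
    "\<And>i j. i \<in> I \<Longrightarrow> j \<in> I \<Longrightarrow> \<exists>k\<in>I. (i, k) \<in> r \<and> (j, k) \<in> r"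
  using assms unfolding directed_index_def partial_order_on_def preorder_on_def refl_on_def
    trans_def antisym_def by blast+

lemma directed_index_cofinal:
  assumes I: "directed_index U I r" and J: "J \<subseteq> I" and cof: "\<And>a. a \<in> I \<Longrightarrow> \<exists>j\<in>J. (a, j) \<in> r"
  shows "directed_index U J (r \<inter> J \<times> J)"
proof -
  note ID = directed_indexD[OF I]
  have "partial_order_on J (r \<inter> J \<times> J)"
    unfolding partial_order_on_def preorder_on_def refl_on_def
  proof (intro conjI ballI transI antisymI)
    show "(i, i) \<in> r \<inter> J \<times> J" if "i \<in> J" for i using that J ID(5) by blast
    show "(i, k) \<in> r \<inter> J \<times> J" if "(i, j) \<in> r \<inter> J \<times> J" "(j, k) \<in> r \<inter> J \<times> J" for i j k
      using that ID(6) by blast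
    show "i = j" if "(i, j) \<in> r \<inter> J \<times> J" "(j, i) \<in> r \<inter> J \<times> J" for i j using that ID(7) by blast
  qed blast
  moreover have "\<exists>k\<in>J. (i, k) \<in> r \<inter> J \<times> J \<and> (j, k) \<in> r \<inter> J \<times> J" if ij: "i \<in> J" "j \<in> J" for i j
  proof -
    obtain a where a: "a \<in> I" "(i, a) \<in> r" "(j, a) \<in> r" using ID(8) J ij by blast
    obtain k where "k \<in> J" "(a, k) \<in> r" using cof a(1) by blast
    then show ?thesis using a ID(6) ij by blast
  qed
  moreover have "J \<subseteq> U" "J \<prec> U" using J ID(1,2) small_subset by blast+
  moreover have "J \<noteq> {}" using ID(3) cof by blast
  ultimately show ?thesis unfolding directed_index_def by blast
qed

lemma direct_systemD:
  assumes "direct_system C I r X \<phi>"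
  shows "\<And>i. i \<in> I \<Longrightarrow> X i \<in> Obj C" "\<And>i j. (i, j) \<in> r \<Longrightarrow> \<phi> i j \<in> Hom C (X i) (X j)"
    "\<And>i. i \<in> I \<Longrightarrow> \<phi> i i = Ide C (X i)"
    "\<And>i j k. (i, j) \<in> r \<Longrightarrow> (j, k) \<in> r \<Longrightarrow> \<phi> j k \<cdot>\<^bsub>C\<^esub> \<phi> i j = \<phi> i k"
  using assms unfolding direct_system_def by blast+

lemma cocone_component:
  assumes "cocone C I r X \<phi> L l"
  shows "L \<in> Obj C" "\<And>i. i \<in> I \<Longrightarrow> l i \<in> Hom C (X i) L" "\<And>i j. (i, j) \<in> r \<Longrightarrow> l j \<cdot>\<^bsub>C\<^esub> \<phi> i j = l i"
  using assms unfolding cocone_def by blast+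

lemma direct_limit_cocone: "direct_limit C I r X \<phi> L l \<Longrightarrow> cocone C I r X \<phi> L l"
  unfolding direct_limit_def by blast

lemma product_cone_tuple:
  assumes "product_cone C I X P p" "Q \<in> Obj C" "\<And>i. i \<in> I \<Longrightarrow> q i \<in> Hom C Q (X i)"
  shows "\<exists>!u. u \<in> Hom C Q P \<and> (\<forall>i\<in>I. p i \<cdot>\<^bsub>C\<^esub> u = q i)"
  using assms unfolding product_cone_def by blast

lemma (in category) direct_limit_eqI:
  assumes L: "direct_limit C I r X \<phi> L l" and sys: "direct_system C I r X \<phi>" and rI: "r \<subseteq> I \<times> I"
    and u: "u \<in> Hom C L M" and v: "v \<in> Hom C L M"
    and eq: "\<And>i. i \<in> I \<Longrightarrow> u \<cdot> l i = v \<cdot> l i"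
  shows "u = v"
proof -
  note co = cocone_component[OF direct_limit_cocone[OF L]]
  have "cocone C I r X \<phi> M (\<lambda>i. u \<cdot> l i)" unfolding cocone_def
  proof (intro conjI ballI, goal_cases)
    case 1 then show ?case using Hom_Obj[OF u] by blast
  next
    case (2 i) then show ?case using Cmp_closed[OF co(2) u] by blast
  next
    case (3 x)
    then show ?case
      using Cmp_assoc[OF direct_systemD(2)[OF sys] co(2) u] co(3) rI by auto
  qed
  then show ?thesis using L u v eq unfolding direct_limit_def by metis
qed

text \<open>
  Surjectivity and injectivity of the comparison map from the direct limit of the sets \<open>Hom(A, X i)\<close>
  to \<open>Hom(A, L)\<close>, in terms of representatives.
\<close>

lemma (in category) finitely_presented_hom_direct_limit:
  assumes A: "finitely_presented U C A" and I: "directed_index U I r"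
    and sys: "direct_system C I r X \<phi>" and L: "direct_limit C I r X \<phi> L l"
  shows "\<And>u. u \<in> Hom C A L \<Longrightarrow> \<exists>i\<in>I. \<exists>v\<in>Hom C A (X i). l i \<cdot> v = u"
    and "\<And>i j v w. i \<in> I \<Longrightarrow> j \<in> I \<Longrightarrow> v \<in> Hom C A (X i) \<Longrightarrow> w \<in> Hom C A (X j) \<Longrightarrow> l i \<cdot> v = l j \<cdot> w
      \<Longrightarrow> \<exists>k\<in>I. (i, k) \<in> r \<and> (j, k) \<in> r \<and> \<phi> i k \<cdot> v = \<phi> j k \<cdot> w"
proof -
  note co = cocone_component[OF direct_limit_cocone[OF L]]
  note sysD = direct_systemD[OF sys]
  define R where "R = {((i, f), (j, g)). i \<in> I \<and> f \<in> Hom C A (X i) \<and> j \<in> I \<and> g \<in> Hom C A (X j) \<and>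
          (\<exists>k\<in>I. (i, k) \<in> r \<and> (j, k) \<in> r \<and> \<phi> i k \<cdot> f = \<phi> j k \<cdot> g)}"
  have bij: "bij_betw (hom_dirlim_map C l) ((SIGMA i:I. Hom C A (X i)) // R) (Hom C A L)"
    using A I sys L unfolding finitely_presented_def hom_dirlim_def R_def by blast
  have push: "l k \<cdot> (\<phi> i k \<cdot> f) = l i \<cdot> f" if "(i, k) \<in> r" "f \<in> Hom C A (X i)" for i k f
    using that co sysD Cmp_assoc[OF that(2) sysD(2)[OF that(1)] co(2)] directed_indexD(4)[OF I] by auto
  have related: "l i \<cdot> f = l j \<cdot> g" if "((i, f), (j, g)) \<in> R" for i f j g
    using that push unfolding R_def by (clarify, metis)
  have self: "((i, f), (i, f)) \<in> R" if "i \<in> I" "f \<in> Hom C A (X i)" for i f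
    using that directed_indexD(5)[OF I] unfolding R_def by auto
  have map: "hom_dirlim_map C l (R `` {(i, f)}) = l i \<cdot> f" if "i \<in> I" "f \<in> Hom C A (X i)" for i f
  proof -
    have "(\<lambda>(i, f). l i \<cdot> f) ` (R `` {(i, f)}) = {l i \<cdot> f}"
    proof (intro equalityI subsetI)
      fix y assume "y \<in> (\<lambda>(i, f). l i \<cdot> f) ` (R `` {(i, f)})"
      then obtain j g where "((i, f), (j, g)) \<in> R" "y = l j \<cdot> g" by auto
      then show "y \<in> {l i \<cdot> f}" using related by simp
    next
      fix y assume "y \<in> {l i \<cdot> f}"
      then show "y \<in> (\<lambda>(i, f). l i \<cdot> f) ` (R `` {(i, f)})" using self[OF that] by force
    qed
    then show ?thesis unfolding hom_dirlim_map_def by simp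
  qed
  show "\<exists>i\<in>I. \<exists>v\<in>Hom C A (X i). l i \<cdot> v = u" if u: "u \<in> Hom C A L" for u
  proof -
    have "u \<in> hom_dirlim_map C l ` ((SIGMA i:I. Hom C A (X i)) // R)"
      using bij_betw_imp_surj_on[OF bij] u by simp
    then obtain c where c: "c \<in> (SIGMA i:I. Hom C A (X i)) // R" "u = hom_dirlim_map C l c"
      by (rule imageE)
    obtain x where x: "x \<in> (SIGMA i:I. Hom C A (X i))" "c = R `` {x}" using c(1) by (rule quotientE)
    obtain i f where xf: "x = (i, f)" by (cases x)
    then have "i \<in> I" "f \<in> Hom C A (X i)" using x by auto
    moreover then have "l i \<cdot> f = u" using map[of i f] c x xf by simp
    ultimately show ?thesis by blast
  qed
  show "\<exists>k\<in>I. (i, k) \<in> r \<and> (j, k) \<in> r \<and> \<phi> i k \<cdot> v = \<phi> j k \<cdot> w"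
    if "i \<in> I" "j \<in> I" "v \<in> Hom C A (X i)" "w \<in> Hom C A (X j)" "l i \<cdot> v = l j \<cdot> w" for i j v w
  proof -
    have "hom_dirlim_map C l (R `` {(i, v)}) = hom_dirlim_map C l (R `` {(j, w)})"
      using map[OF that(1,3)] map[OF that(2,4)] that(5) by simp
    moreover have "R `` {(i, v)} \<in> (SIGMA i:I. Hom C A (X i)) // R"
      "R `` {(j, w)} \<in> (SIGMA i:I. Hom C A (X i)) // R"
      by (rule quotientI, use that in simp)+
    ultimately have "R `` {(i, v)} = R `` {(j, w)}"
      by (rule inj_onD[OF bij_betw_imp_inj_on[OF bij]])
    then have "(j, w) \<in> R `` {(i, v)}" using self[OF that(2,4)] by (simp only: Image_singleton_iff)
    then have "((i, v), (j, w)) \<in> R" by (simp only: Image_singleton_iff)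
    then show ?thesis unfolding R_def by blast
  qed
qed

section \<open>Factorizations and purity\<close>

locale finitely_accessible_category_with_products = additive_category C
  for C :: "('o, 'm, 'z) ab_cat_scheme" (structure) +
  fixes U :: "'u set"
  assumes U: "universe U"
    and accessible: "finitely_accessible U C"
    and products: "has_products U C"
begin

abbreviation fp :: "'o \<Rightarrow> bool" where "fp \<equiv> finitely_presented U C"

lemma Hom_small: "a \<in> Obj C \<Longrightarrow> b \<in> Obj C \<Longrightarrow> Hom C a b \<prec> U"
  using accessible unfolding finitely_accessible_def by blast

lemma fp_Obj: "fp A \<Longrightarrow> A \<in> Obj C"
  unfolding finitely_presented_def by blast

lemma factors_iff:
  assumes "f \<in> Hom C A B" "h \<in> Hom C A X"
  shows "factors C f h \<longleftrightarrow> (\<exists>k\<in>Hom C B X. k \<cdot> f = h)"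
  using HomD[OF assms(1)] HomD[OF assms(2)] unfolding factors_def by simp

lemma factors_Cmp:
  assumes f: "f \<in> Hom C A B" and h: "h \<in> Hom C A X" and g: "g \<in> Hom C X Y" and "factors C f h"
  shows "factors C f (g \<cdot> h)"
proof -
  obtain k where k: "k \<in> Hom C B X" "k \<cdot> f = h" using assms factors_iff by blast
  then show ?thesis
    using factors_iff[OF f Cmp_closed[OF h g]] Cmp_assoc[OF f k(1) g] Cmp_closed[OF k(1) g] by auto
qed

lemma generators:
  obtains G where "G \<prec> U" "\<And>A. A \<in> G \<Longrightarrow> fp A"
    "\<And>L. L \<in> Obj C \<Longrightarrow> \<exists>I r X \<phi> l. directed_index U I r \<and> direct_system C I r X \<phi> \<and>
       (\<forall>i\<in>I. X i \<in> G) \<and> direct_limit C I r X \<phi> L l"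
proof -
  have "\<exists>G. G \<prec> U \<and> (\<forall>A\<in>G. fp A) \<and>
        (\<forall>L\<in>Obj C. \<exists>I r X \<phi> l. directed_index U I r \<and> direct_system C I r X \<phi> \<and>
           (\<forall>i\<in>I. X i \<in> G) \<and> direct_limit C I r X \<phi> L l)"
    using accessible unfolding finitely_accessible_def by blast
  then show thesis using that by metis
qed

text \<open>
  The monomorphism property is automatic: if \<open>m\<close> kills \<open>d : A \<rightarrow> X\<close>, then \<open>m \<cdot> d\<close> factors through the zero
  endomorphism of \<open>A\<close>, so \<open>d\<close> does too. This settles maps from finitely presented objects, and
  those suffice because every object is a direct limit of such objects.
\<close>

lemma pure_monoI:
  assumes m: "m \<in> Hom C X Y"
    and pure: "\<And>A B f h. \<lbrakk>fp A; fp B; f \<in> Hom C A B; h \<in> Hom C A X; factors C f (m \<cdot> h)\<rbrakk> \<Longrightarrow> factors C f h"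
  shows "pure_mono U C X Y m"
proof -
  obtain G where G: "\<And>A. A \<in> G \<Longrightarrow> fp A"
    "\<And>L. L \<in> Obj C \<Longrightarrow> \<exists>I r X \<phi> l. directed_index U I r \<and> direct_system C I r X \<phi> \<and>
       (\<forall>i\<in>I. X i \<in> G) \<and> direct_limit C I r X \<phi> L l"
    by (rule generators) blast
  have fp_mono: "v = w" if A: "fp A" and v: "v \<in> Hom C A X" and w: "w \<in> Hom C A X"
    and e: "m \<cdot> v = m \<cdot> w" for A v w
  proof -
    note X = Hom_Obj(2)[OF v] Hom_Obj(2)[OF m]
    have n: "Nul C A A \<in> Hom C A A" using Nul_closed fp_Obj[OF A] by blast
    obtain d where d: "d \<in> Hom C A X" "w \<oplus>\<^sub>m d = v" using Add_complement[OF w v] by blast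
    have md: "m \<cdot> d \<in> Hom C A Y" "m \<cdot> w \<in> Hom C A Y" using Cmp_closed m d w by blast+
    have "m \<cdot> w \<oplus>\<^sub>m m \<cdot> d = m \<cdot> w \<oplus>\<^sub>m Nul C A Y"
      using Cmp_Add_right[OF w d(1) m] d(2) e Add_Nul[OF md(2)] by simp
    then have "m \<cdot> d = Nul C A Y"
      using Add_left_cancel[OF md(2) md(1) Nul_closed] fp_Obj[OF A] X by blast
    then have "m \<cdot> d \<cdot> Nul C A A = m \<cdot> d"
      using Cmp_Nul_right[OF m fp_Obj[OF A]] Cmp_Nul_right[OF d(1) fp_Obj[OF A]] by simp
    then have "(m \<cdot> d) \<cdot> Nul C A A = m \<cdot> d"
      using Cmp_assoc[OF n d(1) m] by simp
    then have "factors C (Nul C A A) (m \<cdot> d)" using factors_iff[OF n md(1)] md(1) by blast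
    then have "factors C (Nul C A A) d" using pure[OF A A n d(1)] by blast
    then obtain k where "k \<in> Hom C A X" "k \<cdot> Nul C A A = d" using factors_iff[OF n d(1)] by blast
    then have "d = Nul C A X" using Cmp_Nul_right[OF _ fp_Obj[OF A]] by metis
    then show ?thesis using d(2) Add_Nul[OF w] by simp
  qed
  have "mono_arr C X Y m" unfolding mono_arr_def
  proof (intro conjI ballI impI m)
    fix a v w assume a: "a \<in> Obj C" and v: "v \<in> Hom C a X" and w: "w \<in> Hom C a X" and e: "m \<cdot> v = m \<cdot> w"
    obtain I r Z \<phi> l where I: "directed_index U I r" "direct_system C I r Z \<phi>"
      "\<forall>i\<in>I. Z i \<in> G" "direct_limit C I r Z \<phi> a l" using G(2)[OF a] by blast
    note co = cocone_component(2)[OF direct_limit_cocone[OF I(4)]]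
    show "v = w"
    proof (rule direct_limit_eqI[OF I(4,2) directed_indexD(4)[OF I(1)] v w])
      fix i assume i: "i \<in> I"
      have "m \<cdot> (v \<cdot> l i) = m \<cdot> (w \<cdot> l i)"
        using Cmp_assoc[OF co[OF i] v m] Cmp_assoc[OF co[OF i] w m] e by simp
      then show "v \<cdot> l i = w \<cdot> l i"
        using fp_mono[OF G(1)] I(3) i Cmp_closed[OF co[OF i] v] Cmp_closed[OF co[OF i] w] by blast
    qed
  qed
  moreover have "\<exists>k\<in>Hom C B X. k \<cdot> f = h"
    if "fp A" "fp B" "f \<in> Hom C A B" "h \<in> Hom C A X" "h' \<in> Hom C B Y" "h' \<cdot> f = m \<cdot> h" for A B f h h'
  proof -
    have "factors C f (m \<cdot> h)" using factors_iff[OF that(3) Cmp_closed[OF that(4) m]] that by blast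
    then show ?thesis using pure[OF that(1-4)] factors_iff[OF that(3,4)] by blast
  qed
  ultimately show ?thesis using Hom_Obj[OF m] unfolding pure_mono_def by blast
qed

lemma pure_monoD:
  assumes m: "pure_mono U C X Y m"
  shows "m \<in> Hom C X Y"
    and "\<lbrakk>fp A; fp B; f \<in> Hom C A B; h \<in> Hom C A X; factors C f (m \<cdot> h)\<rbrakk> \<Longrightarrow> factors C f h"
proof -
  show mh: "m \<in> Hom C X Y" using m unfolding pure_mono_def mono_arr_def by blast
  assume a: "fp A" "fp B" "f \<in> Hom C A B" "h \<in> Hom C A X" "factors C f (m \<cdot> h)"
  then obtain k where "k \<in> Hom C B Y" "k \<cdot> f = m \<cdot> h"
    using factors_iff[OF a(3) Cmp_closed[OF a(4) mh]] by blast
  then have "\<exists>k\<in>Hom C B X. k \<cdot> f = h" using a m unfolding pure_mono_def by blast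
  then show "factors C f h" using factors_iff[OF a(3,4)] by blast
qed

lemma split_mono_pure:
  assumes m: "m \<in> Hom C X Y" and s: "s \<in> Hom C Y X" and sm: "s \<cdot> m = Ide C X"
  shows "pure_mono U C X Y m"
proof (rule pure_monoI[OF m])
  fix A B f h assume f: "f \<in> Hom C A B" and h: "h \<in> Hom C A X" and "factors C f (m \<cdot> h)"
  then have "factors C f (s \<cdot> m \<cdot> h)" using factors_Cmp[OF f Cmp_closed[OF h m] s] by blast
  then show "factors C f h" using Cmp_assoc[OF h m s] sm Ide_left[OF h] by simp
qed

lemma pure_injective_splits:
  assumes "pure_injective U C X" "pure_mono U C X Y m"
  obtains s where "s \<in> Hom C Y X" "s \<cdot> m = Ide C X"
  using assms Ide_closed[of X] unfolding pure_injective_def by blast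

lemma definableD:
  assumes "definable U C D"
  shows "D \<subseteq> Obj C"
    and "\<lbrakk>product_cone C I X P p; I \<subseteq> U; I \<prec> U; \<And>i. i \<in> I \<Longrightarrow> X i \<in> D\<rbrakk> \<Longrightarrow> P \<in> D"
    and "\<lbrakk>direct_limit C J r X \<phi> L l; directed_index U J r; direct_system C J r X \<phi>; \<And>i. i \<in> J \<Longrightarrow> X i \<in> D\<rbrakk>
        \<Longrightarrow> L \<in> D"
    and "pure_mono U C Y Z m \<Longrightarrow> Z \<in> D \<Longrightarrow> Y \<in> D"
  using assms unfolding definable_def by blast+

end

section \<open>Reduced products\<close>

text \<open>
  \<open>W\<close> is the direct limit, over \<open>i\<close>, of the products of the \<open>Z j\<close> with \<open>j \<ge> i\<close>. A map \<open>germ Q q\<close> to \<open>W\<close> is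
  given by a family \<open>q\<close> of maps to the \<open>Z j\<close>, and it only depends on the values of \<open>q\<close> at all large \<open>j\<close>.
  A general map to \<open>W\<close> need not be of this form, but maps from finitely presented objects are,
  and for these a family is determined by its germ at all large indices.
\<close>

locale reduced_product =
  fixes C :: "('o, 'm, 'z) ab_cat_scheme" (structure) and U :: "'u set"
    and J :: "'u set" and r :: "'u rel" and Z :: "'u \<Rightarrow> 'o" and W :: 'o
    and germ :: "'o \<Rightarrow> ('u \<Rightarrow> 'm) \<Rightarrow> 'm"
  assumes W_Obj: "W \<in> Obj C"
    and W_definable: "definable U C D \<Longrightarrow> (\<And>j. j \<in> J \<Longrightarrow> Z j \<in> D) \<Longrightarrow> W \<in> D"
    and germ_closed: "Q \<in> Obj C \<Longrightarrow> (\<And>j. j \<in> J \<Longrightarrow> q j \<in> Hom C Q (Z j)) \<Longrightarrow> germ Q q \<in> Hom C Q W"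
    and germ_Cmp: "a \<in> Hom C Q' Q \<Longrightarrow> (\<And>j. j \<in> J \<Longrightarrow> q j \<in> Hom C Q (Z j))
        \<Longrightarrow> germ Q' (\<lambda>j. q j \<cdot> a) = germ Q q \<cdot> a"
    and germ_Add: "Q \<in> Obj C \<Longrightarrow> (\<And>j. j \<in> J \<Longrightarrow> q j \<in> Hom C Q (Z j))
        \<Longrightarrow> (\<And>j. j \<in> J \<Longrightarrow> q' j \<in> Hom C Q (Z j))
        \<Longrightarrow> germ Q (\<lambda>j. q j \<oplus>\<^sub>m q' j) = germ Q q \<oplus>\<^sub>m germ Q q'"
    and germ_eqI: "Q \<in> Obj C \<Longrightarrow> (\<And>j. j \<in> J \<Longrightarrow> q j \<in> Hom C Q (Z j))
        \<Longrightarrow> (\<And>j. j \<in> J \<Longrightarrow> q' j \<in> Hom C Q (Z j))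
        \<Longrightarrow> i \<in> J \<Longrightarrow> (\<And>j. (i, j) \<in> r \<Longrightarrow> q j = q' j) \<Longrightarrow> germ Q q = germ Q q'"
    and germ_surj: "finitely_presented U C A \<Longrightarrow> u \<in> Hom C A W
        \<Longrightarrow> \<exists>q. (\<forall>j\<in>J. q j \<in> Hom C A (Z j)) \<and> germ A q = u"
    and germ_eqD: "finitely_presented U C A \<Longrightarrow> (\<And>j. j \<in> J \<Longrightarrow> q j \<in> Hom C A (Z j))
        \<Longrightarrow> (\<And>j. j \<in> J \<Longrightarrow> q' j \<in> Hom C A (Z j)) \<Longrightarrow> germ A q = germ A q'
        \<Longrightarrow> \<exists>i\<in>J. \<forall>j. (i, j) \<in> r \<longrightarrow> q j = q' j"

lemma (in finitely_accessible_category_with_products) reduced_product_exists: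
  assumes J: "directed_index U J r" and Z: "\<And>j. j \<in> J \<Longrightarrow> Z j \<in> Obj C"
  shows "\<exists>W germ. reduced_product C U J r Z W germ"
proof -
  note JD = directed_indexD[OF J]
  define Up where "Up i = {j. (i, j) \<in> r}" for i
  have Up: "Up i \<subseteq> J" for i using JD(4) unfolding Up_def by blast
  have UpU: "Up i \<subseteq> U" "Up i \<prec> U" for i using Up[of i] JD(1,2) small_subset by blast+
  have "\<forall>i. \<exists>P p. product_cone C (Up i) Z P p"
    using products UpU Up Z unfolding has_products_def by blast
  then obtain P p where pc: "\<And>i. product_cone C (Up i) Z (P i) (p i)" by metis
  have P: "P i \<in> Obj C" for i using pc[of i] unfolding product_cone_def by blast
  have p: "p i j \<in> Hom C (P i) (Z j)" if "(i, j) \<in> r" for i j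
    using pc[of i] that unfolding product_cone_def Up_def by blast
  have univ: "\<exists>!u. u \<in> Hom C Q (P i) \<and> (\<forall>j\<in>Up i. p i j \<cdot> u = q j)"
    if "Q \<in> Obj C" "\<And>j. j \<in> Up i \<Longrightarrow> q j \<in> Hom C Q (Z j)" for Q i q
    using pc[of i] that unfolding product_cone_def by blast
  have ext: "u = v" if "u \<in> Hom C Q (P i)" "v \<in> Hom C Q (P i)" "\<And>j. (i, j) \<in> r \<Longrightarrow> p i j \<cdot> u = p i j \<cdot> v"
    for Q i u v
    using univ[of Q i "\<lambda>j. p i j \<cdot> v"] that Hom_Obj[OF that(1)] Cmp_closed[OF that(2) p]
    unfolding Up_def by blast
  define tup where "tup Q i q = (THE u. u \<in> Hom C Q (P i) \<and> (\<forall>j\<in>Up i. p i j \<cdot> u = q j))" for Q i q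
  have tup: "tup Q i q \<in> Hom C Q (P i)" "\<And>j. (i, j) \<in> r \<Longrightarrow> p i j \<cdot> tup Q i q = q j"
    if "Q \<in> Obj C" "\<And>j. j \<in> J \<Longrightarrow> q j \<in> Hom C Q (Z j)" for Q i q
    using theI'[OF univ[of Q i q]] that Up[of i] unfolding tup_def[symmetric] by (auto simp: Up_def)
  have tupI: "u = tup Q i q" if "u \<in> Hom C Q (P i)" "\<And>j. j \<in> J \<Longrightarrow> q j \<in> Hom C Q (Z j)"
    "\<And>j. (i, j) \<in> r \<Longrightarrow> p i j \<cdot> u = q j" for Q i q u
    using ext[OF that(1) tup(1)] tup(2) that Hom_Obj[OF that(1)] by metis
  define res where "res i k = (THE u. u \<in> Hom C (P i) (P k) \<and> (\<forall>j\<in>Up k. p k j \<cdot> u = p i j))" for i k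
  have res: "res i k \<in> Hom C (P i) (P k)" "\<And>j. (k, j) \<in> r \<Longrightarrow> p k j \<cdot> res i k = p i j"
    if "(i, k) \<in> r" for i k
    using theI'[OF univ[of "P i" k "p i"]] P p JD(6)[OF that] unfolding res_def[symmetric]
    by (auto simp: Up_def)
  have sys: "direct_system C J r P res" unfolding direct_system_def
  proof (intro conjI ballI allI impI)
    fix i show "P i \<in> Obj C" by (rule P)
  next
    fix x assume "x \<in> r" then show "case x of (i, j) \<Rightarrow> res i j \<in> Hom C (P i) (P j)" using res by auto
  next
    fix i assume i: "i \<in> J"
    show "res i i = Ide C (P i)"
      by (rule ext[OF res(1)[OF JD(5)[OF i]] Ide_closed[OF P]])
        (use res(2)[OF JD(5)[OF i]] Ide_right[OF p] in simp)
  next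
    fix i j k assume *: "(i, j) \<in> r \<and> (j, k) \<in> r"
    then have ik: "(i, k) \<in> r" using JD(6) by blast
    show "res j k \<cdot> res i j = res i k"
    proof (rule ext)
      show "res j k \<cdot> res i j \<in> Hom C (P i) (P k)" "res i k \<in> Hom C (P i) (P k)"
        using res * ik Cmp_closed by blast+
      fix s assume s: "(k, s) \<in> r"
      then have js: "(j, s) \<in> r" using * JD(6) by blast
      show "p k s \<cdot> res j k \<cdot> res i j = p k s \<cdot> res i k"
        using Cmp_assoc[of "res i j" "P i" "P j" "res j k" "P k" "p k s" "Z s"] p[OF s]
          res[of i j] res[of j k] res[of i k] * ik s js by simp
    qed
  qed
  have "has_direct_limits U C" using accessible unfolding finitely_accessible_def by blast
  then obtain W l where L: "direct_limit C J r P res W l"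
    using J sys unfolding has_direct_limits_def by blast
  note co = cocone_component[OF direct_limit_cocone[OF L]]
  \<comment> \<open>The germ can be computed at any stage of the direct system; \<open>i0\<close> is an arbitrary one.\<close>
  define i0 where "i0 = (SOME i. i \<in> J)"
  have i0: "i0 \<in> J" unfolding i0_def using JD(3) some_in_eq by blast
  define germ where "germ Q q = l i0 \<cdot> tup Q i0 q" for Q q
  have res_tup: "res i k \<cdot> tup Q i q = tup Q k q"
    if ik: "(i, k) \<in> r" and Q: "Q \<in> Obj C" and q: "\<And>j. j \<in> J \<Longrightarrow> q j \<in> Hom C Q (Z j)" for i k Q q
  proof (rule tupI[OF Cmp_closed[OF tup(1)[OF Q q] res(1)[OF ik]] q])
    show "p k j \<cdot> res i k \<cdot> tup Q i q = q j" if j: "(k, j) \<in> r" for j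
      using Cmp_assoc[OF tup(1)[OF Q q] res(1)[OF ik] p[OF j]] res(2)[OF ik j]
        tup(2)[OF Q q] JD(6)[OF ik j] by simp
  qed
  have l_tup: "l i \<cdot> tup Q i q = l k \<cdot> tup Q k q"
    if "(i, k) \<in> r" "Q \<in> Obj C" "\<And>j. j \<in> J \<Longrightarrow> q j \<in> Hom C Q (Z j)" for i k Q q
  proof -
    have k: "k \<in> J" using that JD(4) by blast
    show ?thesis
      using res_tup[OF that] Cmp_assoc[OF tup(1)[OF that(2,3)] res(1)[OF that(1)] co(2)[OF k]] co(3)[OF that(1)]
      by simp
  qed
  have germ: "germ Q q = l i \<cdot> tup Q i q"
    if "i \<in> J" "Q \<in> Obj C" "\<And>j. j \<in> J \<Longrightarrow> q j \<in> Hom C Q (Z j)" for i Q q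
  proof -
    obtain k where "(i0, k) \<in> r" "(i, k) \<in> r" using JD(8) i0 \<open>i \<in> J\<close> by blast
    then show ?thesis using l_tup that unfolding germ_def by metis
  qed
  have "reduced_product C U J r Z W germ"
  proof
    show "W \<in> Obj C" by (rule co(1))
  next
    fix D assume D: "definable U C D" and ZD: "\<And>j. j \<in> J \<Longrightarrow> Z j \<in> D"
    have "P i \<in> D" for i
      by (rule definableD(2)[OF D pc UpU]) (use ZD Up in blast)
    then show "W \<in> D" using definableD(3)[OF D L J sys] by blast
  next
    fix Q q assume "Q \<in> Obj C" "\<And>j. j \<in> J \<Longrightarrow> q j \<in> Hom C Q (Z j)"
    then show "germ Q q \<in> Hom C Q W" using Cmp_closed tup(1) co(2) i0 unfolding germ_def by blast
  next
    fix a Q' Q q assume a: "a \<in> Hom C Q' Q" and q: "\<And>j. j \<in> J \<Longrightarrow> q j \<in> Hom C Q (Z j)"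
    note Q = Hom_Obj[OF a]
    have "tup Q i0 q \<cdot> a = tup Q' i0 (\<lambda>j. q j \<cdot> a)"
    proof (rule tupI)
      show "tup Q i0 q \<cdot> a \<in> Hom C Q' (P i0)" using Cmp_closed[OF a tup(1)[OF Q(2) q]] .
      show "q j \<cdot> a \<in> Hom C Q' (Z j)" if "j \<in> J" for j using Cmp_closed[OF a q] that by blast
      show "p i0 j \<cdot> tup Q i0 q \<cdot> a = q j \<cdot> a" if "(i0, j) \<in> r" for j
        using Cmp_assoc[OF a tup(1)[OF Q(2) q] p[OF that]] tup(2)[OF Q(2) q that] by simp
    qed
    then show "germ Q' (\<lambda>j. q j \<cdot> a) = germ Q q \<cdot> a"
      using Cmp_assoc[OF a tup(1)[OF Q(2) q] co(2)[OF i0]] unfolding germ_def by simp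
  next
    fix Q q q' assume Q: "Q \<in> Obj C" and q: "\<And>j. j \<in> J \<Longrightarrow> q j \<in> Hom C Q (Z j)"
      and q': "\<And>j. j \<in> J \<Longrightarrow> q' j \<in> Hom C Q (Z j)"
    note t = tup(1)[OF Q q] tup(1)[OF Q q']
    have "tup Q i0 q \<oplus>\<^sub>m tup Q i0 q' = tup Q i0 (\<lambda>j. q j \<oplus>\<^sub>m q' j)"
    proof (rule tupI)
      show "tup Q i0 q \<oplus>\<^sub>m tup Q i0 q' \<in> Hom C Q (P i0)" using Add_closed[OF t] .
      show "q j \<oplus>\<^sub>m q' j \<in> Hom C Q (Z j)" if "j \<in> J" for j using Add_closed q q' that by blast
      show "p i0 j \<cdot> (tup Q i0 q \<oplus>\<^sub>m tup Q i0 q') = q j \<oplus>\<^sub>m q' j" if "(i0, j) \<in> r" for j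
        using Cmp_Add_right[OF t p[OF that]] tup(2)[OF Q q that] tup(2)[OF Q q' that] by simp
    qed
    then show "germ Q (\<lambda>j. q j \<oplus>\<^sub>m q' j) = germ Q q \<oplus>\<^sub>m germ Q q'"
      using Cmp_Add_right[OF t co(2)[OF i0]] unfolding germ_def by simp
  next
    fix Q q q' i assume Q: "Q \<in> Obj C" and q: "\<And>j. j \<in> J \<Longrightarrow> q j \<in> Hom C Q (Z j)"
      and q': "\<And>j. j \<in> J \<Longrightarrow> q' j \<in> Hom C Q (Z j)"
      and i: "i \<in> J" and e: "\<And>j. (i, j) \<in> r \<Longrightarrow> q j = q' j"
    have "tup Q i q = tup Q i q'"
      by (rule tupI[OF tup(1)[OF Q q] q']) (use tup(2)[OF Q q] e in auto)
    then show "germ Q q = germ Q q'" using germ[OF i Q q] germ[OF i Q q'] by simp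
  next
    fix A u assume A: "fp A" and u: "u \<in> Hom C A W"
    obtain i v where i: "i \<in> J" and v: "v \<in> Hom C A (P i)" "l i \<cdot> v = u"
      using finitely_presented_hom_direct_limit(1)[OF A J sys L u] by blast
    \<comment> \<open>Families are indexed by all of \<open>J\<close>; at indices not above \<open>i\<close> any value will do.\<close>
    define q where "q j = (if (i, j) \<in> r then p i j \<cdot> v else Nul C A (Z j))" for j
    have q: "q j \<in> Hom C A (Z j)" if "j \<in> J" for j
      using Cmp_closed[OF v(1) p] Nul_closed[OF fp_Obj[OF A] Z[OF that]] unfolding q_def by simp
    have "v = tup A i q" by (rule tupI[OF v(1) q]) (simp_all add: q_def)
    then have "germ A q = u" using germ[OF i fp_Obj[OF A] q] v(2) by simp
    then show "\<exists>q. (\<forall>j\<in>J. q j \<in> Hom C A (Z j)) \<and> germ A q = u" using q by blast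
  next
    fix A q q' assume A: "fp A" and q: "\<And>j. j \<in> J \<Longrightarrow> q j \<in> Hom C A (Z j)"
      and q': "\<And>j. j \<in> J \<Longrightarrow> q' j \<in> Hom C A (Z j)" and e: "germ A q = germ A q'"
    note AO = fp_Obj[OF A]
    obtain k where k: "(i0, k) \<in> r" "res i0 k \<cdot> tup A i0 q = res i0 k \<cdot> tup A i0 q'"
      using finitely_presented_hom_direct_limit(2)[OF A J sys L i0 i0 tup(1)[OF AO q] tup(1)[OF AO q']] e
      unfolding germ_def by blast
    then have "tup A k q = tup A k q'" using res_tup[OF k(1) AO] q q' by simp
    then have "q j = q' j" if "(k, j) \<in> r" for j using tup(2)[OF AO q that] tup(2)[OF AO q' that] by simp
    then show "\<exists>i\<in>J. \<forall>j. (i, j) \<in> r \<longrightarrow> q j = q' j" using k(1) JD(4) by blast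
  qed
  then show ?thesis by blast
qed

section \<open>The exchange property of pure-injective objects\<close>

context finitely_accessible_category_with_products
begin

text \<open>
  The diagonal \<open>\<delta>\<close> from \<open>X\<close> to its reduced power is pure: if \<open>\<delta> \<cdot> h\<close> factors through \<open>f\<close>, then the factor is
  the germ of a family, and already one member of this family yields a factorization of \<open>h\<close>. The
  operator \<open>Lim\<close> is germ formation followed by a retraction of \<open>\<delta>\<close>. It is linear for composition on
  the right, but in general not on the left.
\<close>

lemma pure_injective_limit_operator:
  assumes X: "pure_injective U C X" and J: "directed_index U J r"
  obtains Lim where
    "\<And>q. (\<And>j. j \<in> J \<Longrightarrow> q j \<in> Hom C X X) \<Longrightarrow> Lim q \<in> Hom C X X"
    "\<And>a q. a \<in> Hom C X X \<Longrightarrow> (\<And>j. j \<in> J \<Longrightarrow> q j \<in> Hom C X X) \<Longrightarrow> Lim (\<lambda>j. q j \<cdot> a) = Lim q \<cdot> a"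
    "\<And>q q'. (\<And>j. j \<in> J \<Longrightarrow> q j \<in> Hom C X X) \<Longrightarrow> (\<And>j. j \<in> J \<Longrightarrow> q' j \<in> Hom C X X)
        \<Longrightarrow> Lim (\<lambda>j. q j \<oplus>\<^sub>m q' j) = Lim q \<oplus>\<^sub>m Lim q'"
    "\<And>q q' i. (\<And>j. j \<in> J \<Longrightarrow> q j \<in> Hom C X X) \<Longrightarrow> (\<And>j. j \<in> J \<Longrightarrow> q' j \<in> Hom C X X)
        \<Longrightarrow> i \<in> J \<Longrightarrow> (\<And>j. (i, j) \<in> r \<Longrightarrow> q j = q' j) \<Longrightarrow> Lim q = Lim q'"
    "Lim (\<lambda>j. Ide C X) = Ide C X"
proof -
  have XO: "X \<in> Obj C" using X unfolding pure_injective_def by blast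
  note idX = Ide_closed[OF XO]
  obtain W germ where "reduced_product C U J r (\<lambda>_. X) W germ"
    using reduced_product_exists[OF J, of "\<lambda>_. X"] XO by blast
  then interpret reduced_product C U J r "\<lambda>_. X" W germ .
  define \<delta> where "\<delta> = germ X (\<lambda>_. Ide C X)"
  have \<delta>: "\<delta> \<in> Hom C X W" unfolding \<delta>_def by (rule germ_closed[OF XO idX])
  have \<delta>_Cmp: "\<delta> \<cdot> h = germ A (\<lambda>_. h)" if "h \<in> Hom C A X" for A h
    using germ_Cmp[OF that, of "\<lambda>_. Ide C X"] idX Ide_left[OF that] unfolding \<delta>_def by simp
  have "pure_mono U C X W \<delta>"
  proof (rule pure_monoI[OF \<delta>])
    fix A B f h
    assume A: "fp A" and B: "fp B" and f: "f \<in> Hom C A B" and h: "h \<in> Hom C A X" and "factors C f (\<delta> \<cdot> h)"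
    then obtain k where k: "k \<in> Hom C B W" "k \<cdot> f = \<delta> \<cdot> h"
      using factors_iff[OF f Cmp_closed[OF h \<delta>]] by blast
    obtain q where "\<forall>j\<in>J. q j \<in> Hom C B X" "germ B q = k" using germ_surj[OF B k(1)] by blast
    then have q: "\<And>j. j \<in> J \<Longrightarrow> q j \<in> Hom C B X" "germ B q = k" by blast+
    have "germ A (\<lambda>j. q j \<cdot> f) = germ A (\<lambda>_. h)"
      using germ_Cmp[OF f q(1)] q(2) k(2) \<delta>_Cmp[OF h] by simp
    then have "\<exists>i\<in>J. \<forall>j. (i, j) \<in> r \<longrightarrow> q j \<cdot> f = h"
      using germ_eqD[OF A, of "\<lambda>j. q j \<cdot> f" "\<lambda>_. h"] Cmp_closed[OF f q(1)] h by simp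
    then obtain i where i: "i \<in> J" "\<forall>j. (i, j) \<in> r \<longrightarrow> q j \<cdot> f = h" by blast
    then have "q i \<cdot> f = h" using directed_indexD(5)[OF J i(1)] by simp
    then show "factors C f h" using factors_iff[OF f h] q(1)[OF i(1)] by blast
  qed
  then obtain s where s: "s \<in> Hom C W X" "s \<cdot> \<delta> = Ide C X" using pure_injective_splits[OF X] by blast
  show thesis
  proof (rule that[of "\<lambda>q. s \<cdot> germ X q"])
    fix q assume q: "\<And>j. j \<in> J \<Longrightarrow> q j \<in> Hom C X X"
    note g = germ_closed[OF XO q]
    show "s \<cdot> germ X q \<in> Hom C X X" using Cmp_closed[OF g s(1)] .
    fix a assume "a \<in> Hom C X X"
    then show "s \<cdot> germ X (\<lambda>j. q j \<cdot> a) = (s \<cdot> germ X q) \<cdot> a"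
      using germ_Cmp q Cmp_assoc[OF _ g s(1)] by simp
  next
    fix q q' assume q: "\<And>j. j \<in> J \<Longrightarrow> q j \<in> Hom C X X" and q': "\<And>j. j \<in> J \<Longrightarrow> q' j \<in> Hom C X X"
    show "s \<cdot> germ X (\<lambda>j. q j \<oplus>\<^sub>m q' j) = s \<cdot> germ X q \<oplus>\<^sub>m s \<cdot> germ X q'"
      using germ_Add[OF XO q q'] Cmp_Add_right[OF germ_closed[OF XO q] germ_closed[OF XO q'] s(1)] by simp
    fix i assume i: "i \<in> J" and e: "\<And>j. (i, j) \<in> r \<Longrightarrow> q j = q' j"
    have "germ X q = germ X q'" by (rule germ_eqI[OF XO _ _ i]) (simp_all add: q q' e)
    then show "s \<cdot> germ X q = s \<cdot> germ X q'" by simp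
  next
    show "s \<cdot> germ X (\<lambda>j. Ide C X) = Ide C X" using s(2) unfolding \<delta>_def .
  qed
qed

text \<open>
  Order the decompositions \<open>1 = p + q\<close> by letting \<open>(p', q')\<close> lie above \<open>(p, q)\<close> when \<open>p'\<close> and \<open>q'\<close> are left
  multiples of \<open>p\<close> and \<open>q\<close>. If \<open>p j = x j \<cdot> p i\<close> for all \<open>j\<close> above \<open>i\<close>, then \<open>Lim p = Lim x \<cdot> p i\<close> by right
  linearity, so a chain is bounded by its limit. Let \<open>(e, d)\<close> be maximal above \<open>(a, b)\<close>.

  Maximality is used twice. As \<open>1 = e \<cdot> e + (e + 1) \<cdot> d\<close> lies above \<open>(e, d)\<close>, there is \<open>t\<close> with \<open>e = t \<cdot> e \<cdot> e\<close>.
  Put \<open>c = t \<cdot> e\<close> and \<open>g = 1 - c\<close>. Then \<open>c \<cdot> e = e\<close>, so \<open>g \<cdot> e = 0\<close> and \<open>g = g \<cdot> (e + d) = g \<cdot> d\<close>. So \<open>(c, g)\<close> lies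
  above \<open>(e, d)\<close> as well, and \<open>d = u \<cdot> g\<close> for some \<open>u\<close>. Therefore \<open>d \<cdot> e = u \<cdot> g \<cdot> e = 0\<close>, which says that
  \<open>e\<close> is idempotent.
\<close>

lemma pure_injective_exchange:
  assumes X: "pure_injective U C X" and ab: "a \<in> Hom C X X" "b \<in> Hom C X X" "a \<oplus>\<^sub>m b = Ide C X"
  obtains e d x y where "e \<in> Hom C X X" "d \<in> Hom C X X" "e \<oplus>\<^sub>m d = Ide C X" "e \<cdot> e = e"
    "x \<in> Hom C X X" "e = x \<cdot> a" "y \<in> Hom C X X" "d = y \<cdot> b"
proof -
  have XO: "X \<in> Obj C" using X unfolding pure_injective_def by blast
  define S where "S = Hom C X X"
  define one where "one = Ide C X"
  have S_Cmp: "f \<cdot> g \<in> S" if "f \<in> S" "g \<in> S" for f g using that Cmp_closed unfolding S_def by blast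
  have S_assoc: "(f \<cdot> g) \<cdot> h = f \<cdot> g \<cdot> h" if "f \<in> S" "g \<in> S" "h \<in> S" for f g h
    using that Cmp_assoc unfolding S_def by blast
  have S_Add: "f \<oplus>\<^sub>m g \<in> S" if "f \<in> S" "g \<in> S" for f g using that Add_closed unfolding S_def by blast
  have one: "one \<in> S" using Ide_closed[OF XO] unfolding S_def one_def .
  have one_l: "one \<cdot> f = f" and one_r: "f \<cdot> one = f" if "f \<in> S" for f
    using that Ide_left Ide_right unfolding S_def one_def by blast+
  have distl: "h \<cdot> (f \<oplus>\<^sub>m g) = h \<cdot> f \<oplus>\<^sub>m h \<cdot> g" and distr: "(f \<oplus>\<^sub>m g) \<cdot> h = f \<cdot> h \<oplus>\<^sub>m g \<cdot> h"
    if "f \<in> S" "g \<in> S" "h \<in> S" for f g h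
    using that Cmp_Add_left Cmp_Add_right unfolding S_def by blast+
  define nul where "nul = Nul C X X"
  have nul: "nul \<in> S" using Nul_closed XO unfolding nul_def S_def by blast
  have nul_abs: "f \<cdot> nul = nul" "nul \<cdot> f = nul" "f \<oplus>\<^sub>m nul = f" "nul \<oplus>\<^sub>m f = f" if "f \<in> S" for f
    using that Cmp_Nul_left Cmp_Nul_right Add_Nul XO unfolding nul_def S_def by blast+
  have cancel: "g = nul" if "f \<in> S" "g \<in> S" "f \<oplus>\<^sub>m g = f" for f g
    using that Add_left_cancel[of f X X g nul] nul nul_abs(3)[of f] unfolding S_def by simp
  define P where "P = {(p, q). p \<in> S \<and> q \<in> S \<and> p \<oplus>\<^sub>m q = one}"
  have P_iff: "p \<in> P \<longleftrightarrow> fst p \<in> S \<and> snd p \<in> S \<and> fst p \<oplus>\<^sub>m snd p = one" for p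
    unfolding P_def by (cases p) simp
  define le where "le p p' \<longleftrightarrow> (\<exists>x\<in>S. fst p' = x \<cdot> fst p) \<and> (\<exists>y\<in>S. snd p' = y \<cdot> snd p)" for p p'
  have le_refl: "le p p" if "p \<in> P" for p
  proof -
    have "fst p \<in> S" "snd p \<in> S" using that unfolding P_def by auto
    then have "fst p = one \<cdot> fst p" "snd p = one \<cdot> snd p" using one_l by simp_all
    then show ?thesis using one unfolding le_def by blast
  qed
  have le_trans: "le p p''" if le: "le p p'" "le p' p''" and p: "p \<in> P" for p p' p''
  proof -
    obtain x y x' y' where "x \<in> S" "y \<in> S" "x' \<in> S" "y' \<in> S" "fst p' = x \<cdot> fst p" "snd p' = y \<cdot> snd p"
      "fst p'' = x' \<cdot> fst p'" "snd p'' = y' \<cdot> snd p'" using le unfolding le_def by blast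
    moreover have "fst p \<in> S" "snd p \<in> S" using p unfolding P_def by auto
    ultimately have "fst p'' = (x' \<cdot> x) \<cdot> fst p" "snd p'' = (y' \<cdot> y) \<cdot> snd p" "x' \<cdot> x \<in> S" "y' \<cdot> y \<in> S"
      using S_assoc S_Cmp by simp_all
    then show ?thesis unfolding le_def by blast
  qed
  have ab_P: "(a, b) \<in> P" using ab unfolding P_def S_def one_def by simp
  \<comment> \<open>\<open>le\<close> is only a preorder; passing to principal down-sets turns it into inclusion.\<close>
  define below where "below p = {p' \<in> P. le p' p}" for p
  have below_iff: "below p \<subseteq> below p' \<longleftrightarrow> le p p'" if "p \<in> P" "p' \<in> P" for p p'
    using that le_refl le_trans unfolding below_def by blast
  define Q where "Q = {p \<in> P. le (a, b) p}"
  have "\<exists>M\<in>below ` Q. \<forall>N\<in>below ` Q. M \<subseteq> N \<longrightarrow> N = M"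
  proof (rule subset_Zorn)
    fix K assume K: "subset.chain (below ` Q) K"
    show "\<exists>M\<in>below ` Q. \<forall>N\<in>K. N \<subseteq> M"
    proof (cases "K = {}")
      case True
      then show ?thesis using ab_P le_refl unfolding Q_def by blast
    next
      case False
      have KQ: "K \<subseteq> below ` Q" using K unfolding subset.chain_def by blast
      then have "\<forall>N\<in>K. \<exists>p\<in>Q. below p = N" by blast
      then obtain rep where rep: "\<And>N. N \<in> K \<Longrightarrow> rep N \<in> Q" "\<And>N. N \<in> K \<Longrightarrow> below (rep N) = N" by metis
      have "inj_on rep K" using rep(2) by (rule inj_on_inverseI)
      moreover have "rep ` K \<subseteq> S \<times> S" using rep(1) unfolding Q_def
        by (intro image_subsetI) (simp add: P_iff mem_Times_iff)
      ultimately have "K \<lesssim> S \<times> S" unfolding lepoll_def by blast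
      moreover have "S \<times> S \<prec> U" using small_times[OF U] Hom_small XO unfolding S_def by blast
      ultimately have "K \<prec> U" using lesspoll_trans1 by blast
      then obtain \<iota> where \<iota>: "inj_on \<iota> K" "\<iota> ` K \<subseteq> U" "\<iota> ` K \<prec> U" by (rule small_copy)
      define J where "J = \<iota> ` K"
      define r where "r = {(\<iota> M, \<iota> N) | M N. M \<in> K \<and> N \<in> K \<and> M \<subseteq> N}"
      have r_iff: "(\<iota> M, \<iota> N) \<in> r \<longleftrightarrow> M \<subseteq> N" if "M \<in> K" "N \<in> K" for M N
        using that inj_onD[OF \<iota>(1)] unfolding r_def by blast
      have total: "M \<subseteq> N \<or> N \<subseteq> M" if "M \<in> K" "N \<in> K" for M N
        using that K unfolding subset.chain_def by blast
      have "partial_order_on J r"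
      proof -
        have "r \<subseteq> J \<times> J" unfolding r_def J_def by blast
        moreover have "refl_on J r" unfolding refl_on_def J_def using r_iff by blast
        moreover have "trans r"
        proof (rule transI)
          fix i j k assume "(i, j) \<in> r" "(j, k) \<in> r"
          then obtain L M M' N where *: "i = \<iota> L" "j = \<iota> M" "L \<in> K" "M \<in> K" "L \<subseteq> M"
            "j = \<iota> M'" "k = \<iota> N" "M' \<in> K" "N \<in> K" "M' \<subseteq> N" unfolding r_def by blast
          then have "M = M'" using inj_onD[OF \<iota>(1)] by metis
          then show "(i, k) \<in> r" using * r_iff by auto
        qed
        moreover have "antisym r"
        proof (rule antisymI)
          fix i j assume "(i, j) \<in> r" "(j, i) \<in> r"
          then obtain M N where *: "i = \<iota> M" "j = \<iota> N" "M \<in> K" "N \<in> K" "M \<subseteq> N" unfolding r_def by blast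
          then have "N \<subseteq> M" using \<open>(j, i) \<in> r\<close> r_iff by blast
          then show "i = j" using * by auto
        qed
        ultimately show ?thesis unfolding partial_order_on_def preorder_on_def by blast
      qed
      moreover have "\<forall>i\<in>J. \<forall>j\<in>J. \<exists>k\<in>J. (i, k) \<in> r \<and> (j, k) \<in> r"
      proof (intro ballI)
        fix i j assume "i \<in> J" "j \<in> J"
        then obtain M N where *: "M \<in> K" "i = \<iota> M" "N \<in> K" "j = \<iota> N" unfolding J_def by blast
        show "\<exists>k\<in>J. (i, k) \<in> r \<and> (j, k) \<in> r"
        proof (cases "M \<subseteq> N")
          case True
          then show ?thesis using * r_iff by (intro bexI[of _ j]) (simp_all add: J_def)
        next
          case False
          then show ?thesis using * r_iff total by (intro bexI[of _ i]) (simp_all add: J_def, blast)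
        qed
      qed
      ultimately have J: "directed_index U J r"
        using \<iota> False unfolding directed_index_def J_def by blast
      obtain Lim where Lim_closed: "\<And>q. (\<And>j. j \<in> J \<Longrightarrow> q j \<in> S) \<Longrightarrow> Lim q \<in> S"
        and Lim_Cmp: "\<And>a q. a \<in> S \<Longrightarrow> (\<And>j. j \<in> J \<Longrightarrow> q j \<in> S) \<Longrightarrow> Lim (\<lambda>j. q j \<cdot> a) = Lim q \<cdot> a"
        and Lim_Add: "\<And>q q'. (\<And>j. j \<in> J \<Longrightarrow> q j \<in> S) \<Longrightarrow> (\<And>j. j \<in> J \<Longrightarrow> q' j \<in> S)
            \<Longrightarrow> Lim (\<lambda>j. q j \<oplus>\<^sub>m q' j) = Lim q \<oplus>\<^sub>m Lim q'"
        and Lim_eqI: "\<And>q q' i. (\<And>j. j \<in> J \<Longrightarrow> q j \<in> S) \<Longrightarrow> (\<And>j. j \<in> J \<Longrightarrow> q' j \<in> S)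
            \<Longrightarrow> i \<in> J \<Longrightarrow> (\<And>j. (i, j) \<in> r \<Longrightarrow> q j = q' j) \<Longrightarrow> Lim q = Lim q'"
        and Lim_one: "Lim (\<lambda>j. one) = one"
        by (rule pure_injective_limit_operator[OF X J, folded S_def one_def]) blast
      define p where "p j = rep (inv_into K \<iota> j)" for j
      have p_rep: "p (\<iota> N) = rep N" if "N \<in> K" for N unfolding p_def using \<iota>(1) that by simp
      have pS: "fst (p j) \<in> S" "snd (p j) \<in> S" "fst (p j) \<oplus>\<^sub>m snd (p j) = one" "p j \<in> P" "le (a, b) (p j)"
        if "j \<in> J" for j
      proof -
        have "p j \<in> Q" using that rep(1) p_rep unfolding J_def by auto
        then show "fst (p j) \<in> S" "snd (p j) \<in> S" "fst (p j) \<oplus>\<^sub>m snd (p j) = one" "p j \<in> P" "le (a, b) (p j)"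
          unfolding Q_def by (simp_all add: P_iff)
      qed
      have p_mono: "le (p i) (p j)" if ij: "(i, j) \<in> r" for i j
      proof -
        obtain M N where *: "i = \<iota> M" "j = \<iota> N" "M \<in> K" "N \<in> K" "M \<subseteq> N" using ij unfolding r_def by blast
        then have "rep M \<in> P" "rep N \<in> P" using rep(1) unfolding Q_def by blast+
        then show ?thesis using * below_iff p_rep rep(2) by metis
      qed
      \<comment> \<open>A limit of left multiples is a left multiple, with the limit of the factors.\<close>
      have bound: "\<exists>x\<in>S. Lim \<phi> = x \<cdot> \<phi> i"
        if i: "i \<in> J" and \<phi>: "\<And>j. j \<in> J \<Longrightarrow> \<phi> j \<in> S"
          and div: "\<And>j. (i, j) \<in> r \<Longrightarrow> \<exists>x\<in>S. \<phi> j = x \<cdot> \<phi> i" for \<phi> i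
      proof -
        obtain x where x: "\<And>j. (i, j) \<in> r \<Longrightarrow> x j \<in> S" "\<And>j. (i, j) \<in> r \<Longrightarrow> \<phi> j = x j \<cdot> \<phi> i"
          using div by metis
        define x' where "x' j = (if (i, j) \<in> r then x j else nul)" for j
        have x': "x' j \<in> S" for j using x nul unfolding x'_def by simp
        have "Lim \<phi> = Lim (\<lambda>j. x' j \<cdot> \<phi> i)"
          by (rule Lim_eqI[OF \<phi> S_Cmp[OF x' \<phi>[OF i]] i]) (simp_all add: x'_def x(2))
        also have "\<dots> = Lim x' \<cdot> \<phi> i" by (rule Lim_Cmp[OF \<phi>[OF i] x'])
        finally show ?thesis using Lim_closed[of x', OF x'] by blast
      qed
      define m where "m = (Lim (\<lambda>j. fst (p j)), Lim (\<lambda>j. snd (p j)))"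
      have "Lim (\<lambda>j. fst (p j)) \<oplus>\<^sub>m Lim (\<lambda>j. snd (p j)) = Lim (\<lambda>j. fst (p j) \<oplus>\<^sub>m snd (p j))"
        using Lim_Add[of "\<lambda>j. fst (p j)" "\<lambda>j. snd (p j)"] pS by simp
      also have "\<dots> = Lim (\<lambda>j. one)"
      proof -
        obtain i where i: "i \<in> J" using False unfolding J_def by blast
        show ?thesis
          by (rule Lim_eqI[OF S_Add[OF pS(1,2)] one i]) (use pS(3) directed_indexD(4)[OF J] in auto)
      qed
      finally have mP: "m \<in> P"
        using Lim_one Lim_closed[of "\<lambda>j. fst (p j)"] Lim_closed[of "\<lambda>j. snd (p j)"] pS
        unfolding m_def P_def by simp
      have le_m: "le (p i) m" if i: "i \<in> J" for i
        using bound[OF i, of "\<lambda>j. fst (p j)"] bound[OF i, of "\<lambda>j. snd (p j)"] pS p_mono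
        unfolding le_def m_def by simp
      have "N \<subseteq> below m" if N: "N \<in> K" for N
        using le_m[of "\<iota> N"] p_rep[OF N] below_iff[of "rep N" m] rep[OF N] mP N
        unfolding J_def Q_def by auto
      moreover have "m \<in> Q"
      proof -
        obtain i where i: "i \<in> J" using False unfolding J_def by blast
        show ?thesis using le_trans[OF pS(5)[OF i] le_m[OF i] ab_P] mP unfolding Q_def by blast
      qed
      ultimately show ?thesis by blast
    qed
  qed
  then obtain m where m: "m \<in> Q" and max: "\<And>p. p \<in> Q \<Longrightarrow> below m \<subseteq> below p \<Longrightarrow> below p = below m" by auto
  obtain e d where ed: "m = (e, d)" by (cases m)
  have eS: "e \<in> S" "d \<in> S" "e \<oplus>\<^sub>m d = one" and mP: "(e, d) \<in> P" and "le (a, b) (e, d)"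
    using m unfolding ed Q_def P_def by auto
  then obtain x y where xy: "x \<in> S" "e = x \<cdot> a" "y \<in> S" "d = y \<cdot> b" unfolding le_def by auto
  have maximal: "le (e', d') (e, d)" if "(e', d') \<in> P" "le (e, d) (e', d')" for e' d'
  proof -
    have "(e', d') \<in> Q" using le_trans[OF \<open>le (a, b) (e, d)\<close> that(2) ab_P] that(1) unfolding Q_def by blast
    then have "below (e', d') = below (e, d)" using max below_iff[OF mP that(1)] that ed by blast
    then show ?thesis using below_iff[OF that(1) mP] by blast
  qed
  have "le (e \<cdot> e, (e \<oplus>\<^sub>m one) \<cdot> d) (e, d)"
  proof (rule maximal)
    have ee: "e \<cdot> e \<in> S" "e \<cdot> d \<in> S" "(e \<oplus>\<^sub>m one) \<cdot> d \<in> S" using S_Cmp S_Add eS one by blast+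
    have "e \<cdot> e \<oplus>\<^sub>m (e \<oplus>\<^sub>m one) \<cdot> d = e \<cdot> e \<oplus>\<^sub>m (e \<cdot> d \<oplus>\<^sub>m d)"
      using distr[OF eS(1) one eS(2)] one_l eS by simp
    also have "\<dots> = e \<cdot> (e \<oplus>\<^sub>m d) \<oplus>\<^sub>m d"
      using Add_assoc[of "e \<cdot> e" X X "e \<cdot> d" d] distl[OF eS(1,2,1)] ee eS unfolding S_def by simp
    finally have "e \<cdot> e \<oplus>\<^sub>m (e \<oplus>\<^sub>m one) \<cdot> d = one" using eS one_r by simp
    then show "(e \<cdot> e, (e \<oplus>\<^sub>m one) \<cdot> d) \<in> P" using ee unfolding P_def by simp
    show "le (e, d) (e \<cdot> e, (e \<oplus>\<^sub>m one) \<cdot> d)" using eS S_Add one unfolding le_def by auto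
  qed
  then obtain t where t: "t \<in> S" "e = t \<cdot> e \<cdot> e" unfolding le_def by auto
  define c where "c = t \<cdot> e"
  have c: "c \<in> S" "c \<cdot> e = e" using t S_Cmp S_assoc eS unfolding c_def by auto
  obtain g where g: "g \<in> S" "c \<oplus>\<^sub>m g = one" using Add_complement c(1) one unfolding S_def by blast
  have ge: "g \<cdot> e = nul"
  proof (rule cancel[OF eS(1) S_Cmp[OF g(1) eS(1)]])
    show "e \<oplus>\<^sub>m g \<cdot> e = e" using distr[OF c(1) g(1) eS(1)] c(2) g(2) one_l[OF eS(1)] by simp
  qed
  have gd: "g = g \<cdot> d"
    using distl[OF eS(1,2) g(1)] eS(3) one_r[OF g(1)] ge nul_abs(4)[OF S_Cmp[OF g(1) eS(2)]] by simp
  have "le (c, g) (e, d)"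
  proof (rule maximal)
    show "(c, g) \<in> P" using c g unfolding P_def by simp
    show "le (e, d) (c, g)" using gd g(1) t(1) c_def unfolding le_def by auto
  qed
  then obtain u where u: "u \<in> S" "d = u \<cdot> g" unfolding le_def by auto
  have "d \<cdot> e = nul" using u(2) S_assoc[OF u(1) g(1) eS(1)] ge nul_abs(1)[OF u(1)] by simp
  then have "e \<cdot> e = e"
    using distr[OF eS(1,2,1)] eS(3) one_l[OF eS(1)] nul_abs(3)[OF S_Cmp[OF eS(1,1)]] by simp
  then show thesis using that eS xy unfolding S_def one_def by blast
qed

section \<open>Splitting idempotents\<close>

text \<open>
  The image of \<open>e\<close> is the direct limit of \<open>X \<rightarrow> X \<rightarrow> X \<rightarrow> \<dots>\<close> with all maps equal to \<open>e\<close>. The index set is a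
  copy of the natural numbers inside \<open>U\<close>.
\<close>

lemma idempotent_splits:
  assumes e: "e \<in> Hom C X X" "e \<cdot> e = e"
  obtains L i p where "i \<in> Hom C L X" "p \<in> Hom C X L" "p \<cdot> i = Ide C L" "i \<cdot> p = e"
proof -
  have XO: "X \<in> Obj C" using Hom_Obj e by blast
  note idX = Ide_closed[OF XO]
  have "(UNIV :: nat set) \<prec> U" using U unfolding universe_def by blast
  then obtain \<iota> :: "nat \<Rightarrow> 'u" where \<iota>: "inj \<iota>" "range \<iota> \<subseteq> U" "range \<iota> \<prec> U" by (rule small_copy)
  define r where "r = {(\<iota> m, \<iota> n) | m n. m \<le> n}"
  have r_iff: "(\<iota> m, \<iota> n) \<in> r \<longleftrightarrow> m \<le> n" for m n using injD[OF \<iota>(1)] unfolding r_def by blast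
  have rI: "r \<subseteq> range \<iota> \<times> range \<iota>" unfolding r_def by blast
  have po: "partial_order_on (range \<iota>) r"
    unfolding partial_order_on_def preorder_on_def refl_on_def
  proof (intro conjI rI ballI transI antisymI)
    fix i assume "i \<in> range \<iota>" then show "(i, i) \<in> r" using r_iff by auto
  next
    fix i j k assume *: "(i, j) \<in> r" "(j, k) \<in> r"
    then obtain l m n where "i = \<iota> l" "j = \<iota> m" "k = \<iota> n" using rI by blast
    then show "(i, k) \<in> r" using * r_iff by simp
  next
    fix i j assume *: "(i, j) \<in> r" "(j, i) \<in> r"
    then obtain m n where "i = \<iota> m" "j = \<iota> n" using rI by blast
    then show "i = j" using * r_iff by simp
  qed
  have "\<exists>k\<in>range \<iota>. (i, k) \<in> r \<and> (j, k) \<in> r" if ij: "i \<in> range \<iota>" "j \<in> range \<iota>" for i j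
  proof -
    obtain m n where "i = \<iota> m" "j = \<iota> n" using ij by blast
    then show ?thesis using r_iff by (intro bexI[of _ "\<iota> (max m n)"]) simp_all
  qed
  then have dir: "directed_index U (range \<iota>) r" using po \<iota> unfolding directed_index_def by blast
  define \<phi> where "\<phi> i j = (if i = j then Ide C X else e)" for i j :: 'u
  have \<phi>: "\<phi> i j \<in> Hom C X X" for i j using e idX unfolding \<phi>_def by simp
  have e_\<phi>: "e \<cdot> \<phi> i j = e" for i j using e Ide_right unfolding \<phi>_def by simp
  have sys: "direct_system C (range \<iota>) r (\<lambda>_. X) \<phi>" unfolding direct_system_def
  proof (intro conjI ballI allI impI)
    show "X \<in> Obj C" by (rule XO)
    show "case x of (i, j) \<Rightarrow> \<phi> i j \<in> Hom C X X" for x using \<phi> by (cases x) simp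
    show "\<phi> i i = Ide C X" for i unfolding \<phi>_def by simp
    show "\<phi> j k \<cdot> \<phi> i j = \<phi> i k" if "(i, j) \<in> r \<and> (j, k) \<in> r" for i j k
      using that directed_indexD(7)[OF dir, of i j] e Ide_left Ide_right[OF e(1)] Ide_left[OF idX] Ide_left[OF e(1)]
      unfolding \<phi>_def by auto
  qed
  obtain L l where L: "direct_limit C (range \<iota>) r (\<lambda>_. X) \<phi> L l"
    using accessible dir sys unfolding finitely_accessible_def has_direct_limits_def by blast
  note co = cocone_component[OF direct_limit_cocone[OF L]]
  have l: "l (\<iota> n) \<in> Hom C X L" for n using co(2) by blast
  have lS: "l (\<iota> (Suc n)) \<cdot> e = l (\<iota> n)" for n
  proof -
    have "\<iota> n \<noteq> \<iota> (Suc n)" using injD[OF \<iota>(1), of n "Suc n"] by auto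
    then show ?thesis using co(3)[of "\<iota> n" "\<iota> (Suc n)"] r_iff unfolding \<phi>_def by simp
  qed
  have le: "l (\<iota> n) \<cdot> e = l (\<iota> n)" for n
    using lS[of n] Cmp_assoc[OF e(1) e(1) l[of "Suc n"]] e(2) by simp
  have l0: "l (\<iota> n) = l (\<iota> 0)" for n
  proof (induction n)
    case (Suc n)
    then show ?case using lS[of n] le[of "Suc n"] by simp
  qed simp
  have "cocone C (range \<iota>) r (\<lambda>_. X) \<phi> X (\<lambda>_. e)"
    unfolding cocone_def using XO e(1) e_\<phi> by auto
  then obtain i where i: "i \<in> Hom C L X" "\<And>j. j \<in> range \<iota> \<Longrightarrow> i \<cdot> l j = e"
    using L unfolding direct_limit_def by metis
  have ip: "i \<cdot> l (\<iota> n) = e" for n using i(2) by blast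
  define p where "p = l (\<iota> 0)"
  have p: "p \<in> Hom C X L" "i \<cdot> p = e" using l ip unfolding p_def by blast+
  have "p \<cdot> i = Ide C L"
  proof (rule direct_limit_eqI[OF L sys rI Cmp_closed[OF i(1) p(1)] Ide_closed[OF co(1)]])
    fix j assume "j \<in> range \<iota>"
    then obtain n where j: "j = \<iota> n" by blast
    have "(p \<cdot> i) \<cdot> l (\<iota> n) = p \<cdot> e" using Cmp_assoc[OF l i(1) p(1)] ip by simp
    then show "(p \<cdot> i) \<cdot> l j = Ide C L \<cdot> l j" using le[of 0] l0[of n] Ide_left[OF l] j unfolding p_def by simp
  qed
  then show thesis using that i(1) p by blast
qed

lemma complementary_idempotents:
  assumes e: "e \<in> Hom C X X" "e \<cdot> e = e" and d: "d \<in> Hom C X X" and ed: "e \<oplus>\<^sub>m d = Ide C X"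
  shows "d \<cdot> e = Nul C X X" "e \<cdot> d = Nul C X X" "d \<cdot> d = d"
proof -
  have n: "Nul C X X \<in> Hom C X X" using Nul_closed Hom_Obj e by blast
  have "e \<oplus>\<^sub>m d \<cdot> e = e \<oplus>\<^sub>m Nul C X X"
    using Cmp_Add_left[OF e(1) e(1) d] e ed Ide_left[OF e(1)] Add_Nul[OF e(1)] by simp
  then show "d \<cdot> e = Nul C X X" using Add_left_cancel[OF e(1) Cmp_closed[OF e(1) d] n] by blast
  have "e \<oplus>\<^sub>m e \<cdot> d = e \<oplus>\<^sub>m Nul C X X"
    using Cmp_Add_right[OF e(1) d e(1)] e ed Ide_right[OF e(1)] Add_Nul[OF e(1)] by simp
  then show "e \<cdot> d = Nul C X X" using Add_left_cancel[OF e(1) Cmp_closed[OF d e(1)] n] by blast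
  then show "d \<cdot> d = d"
    using Cmp_Add_left[OF d e(1) d] ed Ide_left[OF d] Add_Nul[OF Cmp_closed[OF d d]] by simp
qed

lemma indecomposable_idempotent:
  assumes X: "indecomposable C X"
    and e: "e \<in> Hom C X X" "e \<cdot> e = e" and d: "d \<in> Hom C X X" and ed: "e \<oplus>\<^sub>m d = Ide C X"
  shows "e = Ide C X \<or> d = Ide C X"
proof -
  note idem = complementary_idempotents[OF assms(2-)]
  obtain a i p where a: "i \<in> Hom C a X" "p \<in> Hom C X a" "p \<cdot> i = Ide C a" "i \<cdot> p = e"
    by (rule idempotent_splits[OF e])
  obtain b j q where b: "j \<in> Hom C b X" "q \<in> Hom C X b" "q \<cdot> j = Ide C b" "j \<cdot> q = d"
    by (rule idempotent_splits[OF d idem(3)])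
  \<comment> \<open>Stated for arbitrary data, as it is used with the two summands in either order.\<close>
  have orth: "q \<cdot> i = Nul C a b"
    if a: "i \<in> Hom C a X" "p \<in> Hom C X a" "p \<cdot> i = Ide C a" "i \<cdot> p = e"
    and b: "j \<in> Hom C b X" "q \<in> Hom C X b" "q \<cdot> j = Ide C b" "j \<cdot> q = d"
    and de: "d \<cdot> e = Nul C X X" and eh: "e \<in> Hom C X X" "d \<in> Hom C X X" for a b i p j q e d
  proof -
    have "e \<cdot> i = i" using Cmp_assoc[OF a(1) a(2) a(1)] a(3,4) Ide_right[OF a(1)] by simp
    moreover have "q \<cdot> d = q" using Cmp_assoc[OF b(2) b(1) b(2)] b(3,4) Ide_left[OF b(2)] by simp
    ultimately have "q \<cdot> i = (q \<cdot> d) \<cdot> (e \<cdot> i)" by simp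
    also have "\<dots> = q \<cdot> ((d \<cdot> e) \<cdot> i)"
      using Cmp_assoc[OF Cmp_closed[OF a(1) eh(1)] eh(2) b(2)] Cmp_assoc[OF a(1) eh] by simp
    also have "\<dots> = Nul C a b"
      using de Cmp_Nul_left[OF a(1)] Cmp_Nul_right[OF b(2)] Hom_Obj[OF a(1)] by simp
    finally show ?thesis .
  qed
  have "biproduct C a b X i j p q"
    using a b ed orth[OF a b idem(1) e(1) d] orth[OF b a idem(2) d e(1)] Hom_Obj[OF a(1)] Hom_Obj[OF b(1)]
    unfolding biproduct_def by blast
  then have "zero_object C a \<or> zero_object C b" using X unfolding indecomposable_def by blast
  moreover have "f = Nul C X X"
    if c: "zero_object C c" and k: "k \<in> Hom C c X" "s \<in> Hom C X c" "k \<cdot> s = f" for c k s f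
  proof -
    have "s = Nul C X c"
      using c k(2) zero_object_iff Cmp_Nul_left[OF k(2)] Ide_left[OF k(2)] Hom_Obj[OF k(2)] by metis
    then show ?thesis using Cmp_Nul_right[OF k(1)] Hom_Obj[OF k(1)] k(3) by simp
  qed
  ultimately have "e = Nul C X X \<or> d = Nul C X X" using a b by blast
  then show ?thesis using ed Add_Nul[OF e(1)] Add_Nul[OF d] by auto
qed

section \<open>Detection by a single map\<close>

text \<open>
  The identity of \<open>A\<close> factors through some stage of any presentation of \<open>A\<close> as a direct limit.
\<close>

lemma fp_retract_of_generator:
  assumes A: "fp A" and G: "\<And>L. L \<in> Obj C \<Longrightarrow> \<exists>I r X \<phi> l. directed_index U I r \<and> direct_system C I r X \<phi> \<and>
       (\<forall>i\<in>I. X i \<in> G) \<and> direct_limit C I r X \<phi> L l"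
  obtains A' i p where "A' \<in> G" "i \<in> Hom C A A'" "p \<in> Hom C A' A" "p \<cdot> i = Ide C A"
proof -
  obtain I r X \<phi> l where I: "directed_index U I r" "direct_system C I r X \<phi>" "\<forall>i\<in>I. X i \<in> G"
    "direct_limit C I r X \<phi> A l" using G[OF fp_Obj[OF A]] by blast
  obtain i v where "i \<in> I" "v \<in> Hom C A (X i)" "l i \<cdot> v = Ide C A"
    using finitely_presented_hom_direct_limit(1)[OF A I(1,2,4) Ide_closed[OF fp_Obj[OF A]]] by blast
  then show thesis
    using that[of "X i" v "l i"] I(3) cocone_component(2)[OF direct_limit_cocone[OF I(4)]] by blast
qed

lemma factors_retract:
  assumes f: "f \<in> Hom C A B" and w: "w \<in> Hom C A Y"
    and i: "i \<in> Hom C A A'" and p: "p \<in> Hom C A' A" and pi: "p \<cdot> i = Ide C A"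
    and j: "j \<in> Hom C B B'" and q: "q \<in> Hom C B' B" and qj: "q \<cdot> j = Ide C B"
  shows "factors C (j \<cdot> f \<cdot> p) (w \<cdot> p) \<longleftrightarrow> factors C f w"
proof -
  note fp' = Cmp_closed[OF p f] and jfp = Cmp_closed[OF Cmp_closed[OF p f] j] and wp = Cmp_closed[OF p w]
  show ?thesis
  proof
    assume "factors C (j \<cdot> f \<cdot> p) (w \<cdot> p)"
    then obtain k where k: "k \<in> Hom C B' Y" "k \<cdot> j \<cdot> f \<cdot> p = w \<cdot> p" using factors_iff[OF jfp wp] by blast
    have "(k \<cdot> j) \<cdot> f = (k \<cdot> j) \<cdot> f \<cdot> p \<cdot> i" using pi Ide_right[OF f] by simp
    also have "\<dots> = (k \<cdot> j \<cdot> f \<cdot> p) \<cdot> i"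
      using Cmp_assoc[OF i p f] Cmp_assoc[OF i fp' j] Cmp_assoc[OF i jfp k(1)]
        Cmp_assoc[OF Cmp_closed[OF i fp'] j k(1)] by simp
    also have "\<dots> = w" using k(2) Cmp_assoc[OF i p w] pi Ide_right[OF w] by simp
    finally show "factors C f w" using factors_iff[OF f w] Cmp_closed[OF j k(1)] by blast
  next
    assume "factors C f w"
    then obtain k where k: "k \<in> Hom C B Y" "k \<cdot> f = w" using factors_iff[OF f w] by blast
    have "(k \<cdot> q) \<cdot> j \<cdot> f \<cdot> p = k \<cdot> ((q \<cdot> j) \<cdot> f \<cdot> p)"
      using Cmp_assoc[OF jfp q k(1)] Cmp_assoc[OF fp' j q] by simp
    also have "\<dots> = w \<cdot> p" using qj Ide_left[OF fp'] Cmp_assoc[OF p f k(1)] k(2) by simp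
    finally show "factors C (j \<cdot> f \<cdot> p) (w \<cdot> p)" using factors_iff[OF jfp wp] Cmp_closed[OF q k(1)] by blast
  qed
qed

text \<open>
  By passing to retracts it suffices to treat \<open>f\<close> and \<open>h\<close> with \<open>A\<close> and \<open>B\<close> in a small set of generators.
  Such pairs form a small set. Let \<open>T\<close> consist of those for which some map from \<open>X\<close> to an object of \<open>D\<close> sees
  that \<open>h\<close> does not factor through \<open>f\<close>; then \<open>Z\<close> is the product of one such object for each member of \<open>T\<close>.
\<close>

lemma weak_reflection:
  assumes D: "definable U C D" and X: "X \<in> Obj C"
  obtains Z m where "Z \<in> D" "m \<in> Hom C X Z"
    "\<And>A B f h Z' g. \<lbrakk>fp A; fp B; f \<in> Hom C A B; h \<in> Hom C A X; factors C f (m \<cdot> h); Z' \<in> D; g \<in> Hom C X Z'\<rbrakk>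
       \<Longrightarrow> factors C f (g \<cdot> h)"
proof -
  obtain G where G: "G \<prec> U" "\<And>A. A \<in> G \<Longrightarrow> fp A"
    "\<And>L. L \<in> Obj C \<Longrightarrow> \<exists>I r X \<phi> l. directed_index U I r \<and> direct_system C I r X \<phi> \<and>
       (\<forall>i\<in>I. X i \<in> G) \<and> direct_limit C I r X \<phi> L l"
    by (rule generators) blast
  define T where "T = {(f, h). \<exists>A\<in>G. \<exists>B\<in>G. f \<in> Hom C A B \<and> h \<in> Hom C A X \<and>
    (\<exists>Z\<in>D. \<exists>g\<in>Hom C X Z. \<not> factors C f (g \<cdot> h))}"
  have "T \<subseteq> (\<lambda>(A, B, f, h). (f, h)) ` (SIGMA A:G. SIGMA B:G. Hom C A B \<times> Hom C A X)"
    unfolding T_def by force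
  moreover have "(SIGMA A:G. SIGMA B:G. Hom C A B \<times> Hom C A X) \<prec> U"
    by (intro small_Sigma[OF U] small_times[OF U] G(1) Hom_small fp_Obj G(2) X)
  ultimately have "T \<prec> U" using subset_image_lepoll lesspoll_trans1 by blast
  then obtain \<iota> where \<iota>: "inj_on \<iota> T" "\<iota> ` T \<subseteq> U" "\<iota> ` T \<prec> U" by (rule small_copy)
  have "\<forall>t\<in>T. \<exists>Z g. Z \<in> D \<and> g \<in> Hom C X Z \<and> \<not> factors C (fst t) (g \<cdot> snd t)"
    unfolding T_def by fastforce
  then obtain Z g where Zg: "\<And>t. t \<in> T \<Longrightarrow> Z t \<in> D" "\<And>t. t \<in> T \<Longrightarrow> g t \<in> Hom C X (Z t)"
    "\<And>t. t \<in> T \<Longrightarrow> \<not> factors C (fst t) (g t \<cdot> snd t)" by metis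
  define d where "d = inv_into T \<iota>"
  have d: "d (\<iota> t) = t" if "t \<in> T" for t using that \<iota>(1) unfolding d_def by simp
  have Zd: "Z (d i) \<in> D" "g (d i) \<in> Hom C X (Z (d i))" if "i \<in> \<iota> ` T" for i using that Zg d by auto
  have "\<forall>i\<in>\<iota> ` T. Z (d i) \<in> Obj C" using Zd definableD(1)[OF D] by blast
  then have "\<exists>P p. product_cone C (\<iota> ` T) (\<lambda>i. Z (d i)) P p"
    using products[unfolded has_products_def, rule_format, of "\<iota> ` T" "\<lambda>i. Z (d i)"] \<iota>(2,3) by blast
  then obtain P p where P: "product_cone C (\<iota> ` T) (\<lambda>i. Z (d i)) P p" by blast
  then have "\<forall>i\<in>\<iota> ` T. p i \<in> Hom C P (Z (d i))" unfolding product_cone_def by blast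
  then have p: "p i \<in> Hom C P (Z (d i))" if "i \<in> \<iota> ` T" for i using that by blast
  have "\<exists>!m. m \<in> Hom C X P \<and> (\<forall>i\<in>\<iota> ` T. p i \<cdot> m = g (d i))"
    by (rule product_cone_tuple[OF P X Zd(2)])
  then obtain m where m: "m \<in> Hom C X P" "\<And>i. i \<in> \<iota> ` T \<Longrightarrow> p i \<cdot> m = g (d i)" by blast
  show thesis
  proof (rule that[of P m])
    show "P \<in> D" by (rule definableD(2)[OF D P \<iota>(2,3) Zd(1)])
    show "m \<in> Hom C X P" by (rule m(1))
    fix A B f h Z' g'
    assume A: "fp A" and B: "fp B" and f: "f \<in> Hom C A B" and h: "h \<in> Hom C A X"
      and mh: "factors C f (m \<cdot> h)" and Z': "Z' \<in> D" and g': "g' \<in> Hom C X Z'"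
    obtain A' u v where A': "A' \<in> G" "u \<in> Hom C A A'" "v \<in> Hom C A' A" "v \<cdot> u = Ide C A"
      by (rule fp_retract_of_generator[OF A G(3)])
    obtain B' j q where B': "B' \<in> G" "j \<in> Hom C B B'" "q \<in> Hom C B' B" "q \<cdot> j = Ide C B"
      by (rule fp_retract_of_generator[OF B G(3)])
    note ret = factors_retract[OF f _ A'(2-4) B'(2-4)]
    define t where "t = (j \<cdot> f \<cdot> v, h \<cdot> v)"
    have t: "fst t \<in> Hom C A' B'" "snd t \<in> Hom C A' X"
      using Cmp_closed[OF Cmp_closed[OF A'(3) f] B'(2)] Cmp_closed[OF A'(3) h] unfolding t_def by simp_all
    have ret': "factors C (fst t) (w \<cdot> snd t) \<longleftrightarrow> factors C f (w \<cdot> h)" if "w \<in> Hom C X Y" for w Y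
      using ret[OF Cmp_closed[OF h that]] Cmp_assoc[OF A'(3) h that] unfolding t_def by simp
    show "factors C f (g' \<cdot> h)"
    proof (rule ccontr)
      assume "\<not> factors C f (g' \<cdot> h)"
      then have "\<not> factors C (fst t) (g' \<cdot> snd t)" using ret'[OF g'] by simp
      then have tT: "t \<in> T" using A'(1) B'(1) t Z' g' unfolding T_def by (cases t) auto
      have "factors C (fst t) (p (\<iota> t) \<cdot> m \<cdot> snd t)"
        using factors_Cmp[OF t(1) Cmp_closed[OF t(2) m(1)] p] tT ret'[OF m(1)] mh by blast
      then show False
        using Zg(3)[OF tT] Cmp_assoc[OF t(2) m(1) p[OF imageI[OF tT]]] m(2)[of "\<iota> t"] d[OF tT] tT by simp
    qed
  qed
qed

end

section \<open>The join of two definable subcategories\<close>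

text \<open>
  The condition is the contrapositive of detection: \<open>h\<close> factors as soon as all its composites with maps
  to objects of \<open>D1\<close> or \<open>D2\<close> do. By \<open>weak_reflection\<close> these objects are the pure subobjects of sums
  \<open>Z1 \<oplus> Z2\<close> with \<open>Zi\<close> in \<open>Di\<close>, so this is the smallest definable subcategory that contains both. The
  form chosen here passes easily to products and through the tensor-hom adjunction, and it involves
  no choice of embeddings, which need not be compatible with the maps of a direct system.
\<close>

definition definable_join :: "'u set \<Rightarrow> ('o, 'm, 'z) ab_cat_scheme \<Rightarrow> 'o set \<Rightarrow> 'o set \<Rightarrow> 'o set" where
  "definable_join U C D1 D2 = {X \<in> Obj C. \<forall>A B f h.
     finitely_presented U C A \<and> finitely_presented U C B \<and> f \<in> Hom C A B \<and> h \<in> Hom C A X \<and>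
     (\<forall>Z\<in>D1 \<union> D2. \<forall>g\<in>Hom C X Z. factors C f (g \<cdot>\<^bsub>C\<^esub> h)) \<longrightarrow> factors C f h}"

context finitely_accessible_category_with_products
begin

lemma definable_joinI:
  assumes "X \<in> Obj C"
    and "\<And>A B f h. \<lbrakk>fp A; fp B; f \<in> Hom C A B; h \<in> Hom C A X;
      \<And>Z g. Z \<in> D1 \<union> D2 \<Longrightarrow> g \<in> Hom C X Z \<Longrightarrow> factors C f (g \<cdot> h)\<rbrakk> \<Longrightarrow> factors C f h"
  shows "X \<in> definable_join U C D1 D2"
  using assms unfolding definable_join_def by blast

lemma definable_joinD:
  assumes "X \<in> definable_join U C D1 D2"
    and "fp A" "fp B" "f \<in> Hom C A B" "h \<in> Hom C A X"
    and "\<And>Z g. Z \<in> D1 \<union> D2 \<Longrightarrow> g \<in> Hom C X Z \<Longrightarrow> factors C f (g \<cdot> h)"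
  shows "factors C f h"
  using assms unfolding definable_join_def by blast

lemma definable_join_Obj: "X \<in> definable_join U C D1 D2 \<Longrightarrow> X \<in> Obj C"
  unfolding definable_join_def by blast

lemma definable_join_upper:
  assumes "definable U C D1" "definable U C D2"
  shows "D1 \<union> D2 \<subseteq> definable_join U C D1 D2"
proof
  fix X assume X: "X \<in> D1 \<union> D2"
  then have XO: "X \<in> Obj C" using assms definableD(1) by blast
  show "X \<in> definable_join U C D1 D2"
  proof (rule definable_joinI[OF XO])
    fix A B f h assume h: "h \<in> Hom C A X"
      and "\<And>Z g. Z \<in> D1 \<union> D2 \<Longrightarrow> g \<in> Hom C X Z \<Longrightarrow> factors C f (g \<cdot> h)"
    then show "factors C f h" using X Ide_closed[OF XO] Ide_left[OF h] by metis
  qed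
qed

lemma definable_join_product:
  assumes P: "product_cone C I X P p" and X: "\<And>i. i \<in> I \<Longrightarrow> X i \<in> definable_join U C D1 D2"
  shows "P \<in> definable_join U C D1 D2"
proof (rule definable_joinI)
  show PO: "P \<in> Obj C" using P unfolding product_cone_def by blast
  fix A B f h
  assume A: "fp A" and B: "fp B" and f: "f \<in> Hom C A B" and h: "h \<in> Hom C A P"
    and det: "\<And>Z g. Z \<in> D1 \<union> D2 \<Longrightarrow> g \<in> Hom C P Z \<Longrightarrow> factors C f (g \<cdot> h)"
  have "\<forall>i\<in>I. p i \<in> Hom C P (X i)" using P unfolding product_cone_def by blast
  then have p: "p i \<in> Hom C P (X i)" if "i \<in> I" for i using that by blast
  have "\<exists>k\<in>Hom C B (X i). k \<cdot> f = p i \<cdot> h" if i: "i \<in> I" for i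
  proof -
    have "factors C f (p i \<cdot> h)"
    proof (rule definable_joinD[OF X[OF i] A B f Cmp_closed[OF h p[OF i]]])
      fix Z g assume "Z \<in> D1 \<union> D2" and g: "g \<in> Hom C (X i) Z"
      then show "factors C f (g \<cdot> p i \<cdot> h)"
        using det[of Z "g \<cdot> p i"] Cmp_closed[OF p[OF i] g] Cmp_assoc[OF h p[OF i] g] by simp
    qed
    then show ?thesis using factors_iff[OF f Cmp_closed[OF h p[OF i]]] by blast
  qed
  then obtain k where k: "\<And>i. i \<in> I \<Longrightarrow> k i \<in> Hom C B (X i)" "\<And>i. i \<in> I \<Longrightarrow> k i \<cdot> f = p i \<cdot> h" by metis
  have "\<exists>!u. u \<in> Hom C B P \<and> (\<forall>i\<in>I. p i \<cdot> u = k i)"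
    by (rule product_cone_tuple[OF P fp_Obj[OF B] k(1)])
  then obtain u where u: "u \<in> Hom C B P" "\<forall>i\<in>I. p i \<cdot> u = k i" by blast
  have uf: "u \<cdot> f \<in> Hom C A P" using Cmp_closed[OF f u(1)] .
  have "\<exists>!w. w \<in> Hom C A P \<and> (\<forall>i\<in>I. p i \<cdot> w = p i \<cdot> h)"
    by (rule product_cone_tuple[OF P fp_Obj[OF A] Cmp_closed[OF h p]])
  moreover have "p i \<cdot> u \<cdot> f = p i \<cdot> h" if "i \<in> I" for i
    using Cmp_assoc[OF f u(1) p[OF that]] u(2) k(2) that by simp
  ultimately have "u \<cdot> f = h" using uf h by blast
  then show "factors C f h" using factors_iff[OF f h] u(1) by blast
qed

text \<open>
  If \<open>h = l i \<cdot> v\<close> does not factor through \<open>f\<close>, neither does \<open>\<phi> i j \<cdot> v\<close> for any \<open>j\<close> above \<open>i\<close>, and this is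
  detected by some \<open>g j : X j \<rightarrow> Z j\<close>. As a directed set is not the union of two sets that both fail to
  be cofinal, the \<open>Z j\<close> can be taken from one fixed subcategory for cofinally many \<open>j\<close>. The germs of
  the families \<open>j \<mapsto> g j \<cdot> \<phi> k j\<close> form a cocone, and the induced map from \<open>L\<close> to the reduced product
  detects \<open>h\<close>: a factorization there would yield one of \<open>g j \<cdot> \<phi> i j \<cdot> v\<close> for some \<open>j\<close>.
\<close>

lemma definable_join_direct_limit:
  assumes D1: "definable U C D1" and D2: "definable U C D2"
    and L: "direct_limit C I r X \<phi> L l" and I: "directed_index U I r" and sys: "direct_system C I r X \<phi>"
    and X: "\<And>i. i \<in> I \<Longrightarrow> X i \<in> definable_join U C D1 D2"
  shows "L \<in> definable_join U C D1 D2"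
proof (rule definable_joinI)
  note ID = directed_indexD[OF I] and sysD = direct_systemD[OF sys]
  note co = cocone_component[OF direct_limit_cocone[OF L]]
  show "L \<in> Obj C" by (rule co(1))
  fix A B f h
  assume A: "fp A" and B: "fp B" and f: "f \<in> Hom C A B" and h: "h \<in> Hom C A L"
    and det: "\<And>Z g. Z \<in> D1 \<union> D2 \<Longrightarrow> g \<in> Hom C L Z \<Longrightarrow> factors C f (g \<cdot> h)"
  show "factors C f h"
  proof (rule ccontr)
    assume nh: "\<not> factors C f h"
    obtain i v where i: "i \<in> I" and v: "v \<in> Hom C A (X i)" "l i \<cdot> v = h"
      using finitely_presented_hom_direct_limit(1)[OF A I sys L h] by blast
    have detected: "\<exists>Z g. Z \<in> D1 \<union> D2 \<and> g \<in> Hom C (X j) Z \<and> \<not> factors C f (g \<cdot> \<phi> i j \<cdot> v)" if ij: "(i, j) \<in> r" for j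
    proof (rule ccontr)
      assume none: "\<not> ?thesis"
      have j: "j \<in> I" using ij ID(4) by blast
      have w: "\<phi> i j \<cdot> v \<in> Hom C A (X j)" using Cmp_closed[OF v(1) sysD(2)[OF ij]] .
      have "factors C f (\<phi> i j \<cdot> v)"
        by (rule definable_joinD[OF X[OF j] A B f w]) (use none in blast)
      then have "factors C f (l j \<cdot> \<phi> i j \<cdot> v)" by (rule factors_Cmp[OF f w co(2)[OF j]])
      then show False
        using nh v(2) Cmp_assoc[OF v(1) sysD(2)[OF ij] co(2)[OF j]] co(3)[OF ij] by simp
    qed
    then obtain Z g where Zg: "\<And>j. (i, j) \<in> r \<Longrightarrow> Z j \<in> D1 \<union> D2" "\<And>j. (i, j) \<in> r \<Longrightarrow> g j \<in> Hom C (X j) (Z j)"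
      "\<And>j. (i, j) \<in> r \<Longrightarrow> \<not> factors C f (g j \<cdot> \<phi> i j \<cdot> v)" by metis
    define above where "above D = {j. (i, j) \<in> r \<and> Z j \<in> D}" for D
    obtain D where D: "D = D1 \<or> D = D2" and cof: "\<And>a. a \<in> I \<Longrightarrow> \<exists>j\<in>above D. (a, j) \<in> r"
    proof (cases "\<forall>a\<in>I. \<exists>j\<in>above D1. (a, j) \<in> r")
      case True
      then show ?thesis using that[of D1] by blast
    next
      case False
      then obtain b where b: "b \<in> I" "\<And>j. j \<in> above D1 \<Longrightarrow> (b, j) \<notin> r" by blast
      have "\<exists>j\<in>above D2. (a, j) \<in> r" if a: "a \<in> I" for a
      proof -
        obtain c where c: "c \<in> I" "(a, c) \<in> r" "(b, c) \<in> r" using ID(8)[OF a b(1)] by blast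
        obtain j where j: "j \<in> I" "(c, j) \<in> r" "(i, j) \<in> r" using ID(8)[OF c(1) i] by blast
        then have "(a, j) \<in> r" "(b, j) \<in> r" using c ID(6) by blast+
        then have "j \<in> above D2" using b(2)[of j] Zg(1)[OF j(3)] j(3) unfolding above_def by blast
        then show ?thesis using \<open>(a, j) \<in> r\<close> by blast
      qed
      then show ?thesis using that[of D2] by blast
    qed
    define J where "J = above D"
    have Ji: "(i, j) \<in> r" "Z j \<in> D" if "j \<in> J" for j using that unfolding J_def above_def by auto
    have JI: "J \<subseteq> I" using Ji(1) ID(4) by blast
    have Ddef: "definable U C D" using D D1 D2 by blast
    have J: "directed_index U J (r \<inter> J \<times> J)"
      by (rule directed_index_cofinal[OF I JI]) (use cof in \<open>simp add: J_def\<close>)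
    have ZO: "Z j \<in> Obj C" if "j \<in> J" for j using Ji(2)[OF that] definableD(1)[OF Ddef] by blast
    obtain W germ where "reduced_product C U J (r \<inter> J \<times> J) Z W germ"
      using reduced_product_exists[OF J, of Z] ZO by blast
    then interpret reduced_product C U J "r \<inter> J \<times> J" Z W germ .
    have WD: "W \<in> D" by (rule W_definable[OF Ddef Ji(2)])
    define q where "q k j = (if (k, j) \<in> r then g j \<cdot> \<phi> k j else Nul C (X k) (Z j))" for k j
    have q: "q k j \<in> Hom C (X k) (Z j)" if "k \<in> I" "j \<in> J" for k j
      using Cmp_closed[OF sysD(2) Zg(2)[OF Ji(1)[OF that(2)]]] Nul_closed[OF sysD(1)[OF that(1)] ZO[OF that(2)]]
      unfolding q_def by simp
    have "cocone C I r X \<phi> W (\<lambda>k. germ (X k) (q k))" unfolding cocone_def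
    proof (intro conjI ballI)
      show "W \<in> Obj C" by (rule W_Obj)
      show "germ (X k) (q k) \<in> Hom C (X k) W" if k: "k \<in> I" for k
        by (rule germ_closed[OF sysD(1)[OF k] q[OF k]])
      fix x assume "x \<in> r"
      then obtain k k' where x: "x = (k, k')" and kk: "(k, k') \<in> r" by (cases x) blast
      have k: "k \<in> I" "k' \<in> I" using kk ID(4) by blast+
      obtain n where n: "n \<in> J" "(k', n) \<in> r" using cof[OF k(2)] unfolding J_def by blast
      have "germ (X k') (q k') \<cdot> \<phi> k k' = germ (X k) (\<lambda>j. q k' j \<cdot> \<phi> k k')"
        using germ_Cmp[OF sysD(2)[OF kk], of "q k'"] q[OF k(2)] by simp
      also have "\<dots> = germ (X k) (q k)"
      proof (rule germ_eqI[OF sysD(1)[OF k(1)] Cmp_closed[OF sysD(2)[OF kk] q[OF k(2)]] q[OF k(1)] n(1)])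
        fix j assume j: "(n, j) \<in> r \<inter> J \<times> J"
        then have k'j: "(k', j) \<in> r" and kj: "(k, j) \<in> r" using n(2) kk ID(6) by blast+
        show "q k' j \<cdot> \<phi> k k' = q k j"
          using k'j kj Cmp_assoc[OF sysD(2)[OF kk] sysD(2)[OF k'j] Zg(2)[OF Ji(1)]] sysD(4)[OF kk k'j] j
          unfolding q_def by simp
      qed
      finally show "case x of (k, k') \<Rightarrow> germ (X k') (q k') \<cdot> \<phi> k k' = germ (X k) (q k)" using x by simp
    qed
    then have "\<exists>!u. u \<in> Hom C L W \<and> (\<forall>k\<in>I. u \<cdot> l k = germ (X k) (q k))"
      using L unfolding direct_limit_def by blast
    then obtain u where u: "u \<in> Hom C L W" "\<forall>k\<in>I. u \<cdot> l k = germ (X k) (q k)" by blast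
    have uh: "u \<cdot> h = germ A (\<lambda>j. q i j \<cdot> v)"
      using Cmp_assoc[OF v(1) co(2)[OF i] u(1)] v(2) u(2) i germ_Cmp[OF v(1), of "q i"] q[OF i] by simp
    have "factors C f (u \<cdot> h)" by (rule det[OF _ u(1)]) (use WD D in blast)
    then obtain k where k: "k \<in> Hom C B W" "k \<cdot> f = u \<cdot> h"
      using factors_iff[OF f Cmp_closed[OF h u(1)]] by blast
    obtain s where "\<forall>j\<in>J. s j \<in> Hom C B (Z j)" and s_k: "germ B s = k" using germ_surj[OF B k(1)] by blast
    then have s: "s j \<in> Hom C B (Z j)" if "j \<in> J" for j using that by blast
    have "germ A (\<lambda>j. s j \<cdot> f) = germ A (\<lambda>j. q i j \<cdot> v)"
      using germ_Cmp[OF f, of s] s s_k k(2) uh by simp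
    then have "\<exists>n\<in>J. \<forall>j. (n, j) \<in> r \<inter> J \<times> J \<longrightarrow> s j \<cdot> f = q i j \<cdot> v"
      using germ_eqD[OF A, of "\<lambda>j. s j \<cdot> f" "\<lambda>j. q i j \<cdot> v"] Cmp_closed[OF f s] Cmp_closed[OF v(1) q[OF i]]
      by simp
    then obtain n where n: "n \<in> J" "\<forall>j. (n, j) \<in> r \<inter> J \<times> J \<longrightarrow> s j \<cdot> f = q i j \<cdot> v" by blast
    have "(n, n) \<in> r \<inter> J \<times> J" using directed_indexD(5)[OF J n(1)] .
    then have "s n \<cdot> f = (g n \<cdot> \<phi> i n) \<cdot> v" using n(2) Ji(1)[OF n(1)] unfolding q_def by simp
    also have "\<dots> = g n \<cdot> \<phi> i n \<cdot> v" by (rule Cmp_assoc[OF v(1) sysD(2) Zg(2)]) (use Ji(1)[OF n(1)] in blast)+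
    finally have "factors C f (g n \<cdot> \<phi> i n \<cdot> v)"
      using factors_iff[OF f Cmp_closed[OF Cmp_closed[OF v(1) sysD(2)] Zg(2)]] s[OF n(1)] Ji(1)[OF n(1)] by blast
    then show False using Zg(3)[OF Ji(1)[OF n(1)]] by blast
  qed
qed

lemma definable_join_pure_subobject:
  assumes m: "pure_mono U C X Y m" and Y: "Y \<in> definable_join U C D1 D2"
  shows "X \<in> definable_join U C D1 D2"
proof (rule definable_joinI)
  note mh = pure_monoD(1)[OF m]
  show "X \<in> Obj C" using Hom_Obj[OF mh] by blast
  fix A B f h
  assume A: "fp A" and B: "fp B" and f: "f \<in> Hom C A B" and h: "h \<in> Hom C A X"
    and det: "\<And>Z g. Z \<in> D1 \<union> D2 \<Longrightarrow> g \<in> Hom C X Z \<Longrightarrow> factors C f (g \<cdot> h)"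
  have "factors C f (m \<cdot> h)"
  proof (rule definable_joinD[OF Y A B f Cmp_closed[OF h mh]])
    fix Z g assume "Z \<in> D1 \<union> D2" and g: "g \<in> Hom C Y Z"
    then show "factors C f (g \<cdot> m \<cdot> h)"
      using det[of Z "g \<cdot> m"] Cmp_closed[OF mh g] Cmp_assoc[OF h mh g] by simp
  qed
  then show "factors C f h" by (rule pure_monoD(2)[OF m A B f h])
qed

lemma definable_definable_join:
  assumes "definable U C D1" "definable U C D2"
  shows "definable U C (definable_join U C D1 D2)"
  unfolding definable_def
proof (intro conjI allI impI)
  show "definable_join U C D1 D2 \<subseteq> Obj C" using definable_join_Obj by blast
next
  fix I X P p
  assume *: "I \<subseteq> U \<and> I \<prec> U \<and> (\<forall>i\<in>I. X i \<in> definable_join U C D1 D2) \<and> product_cone C I X P p"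
  show "P \<in> definable_join U C D1 D2" by (rule definable_join_product[of I X P p]) (use * in auto)
next
  fix I r X \<phi> L l
  assume *: "directed_index U I r \<and> direct_system C I r X \<phi> \<and>
    (\<forall>i\<in>I. X i \<in> definable_join U C D1 D2) \<and> direct_limit C I r X \<phi> L l"
  show "L \<in> definable_join U C D1 D2"
    by (rule definable_join_direct_limit[OF assms, of I r X \<phi> L l]) (use * in auto)
next
  fix X Y m assume "pure_mono U C X Y m \<and> Y \<in> definable_join U C D1 D2"
  then show "X \<in> definable_join U C D1 D2" using definable_join_pure_subobject[of X Y m] by simp
qed

text \<open>
  The identity of \<open>X\<close> is a sum of an endomorphism through \<open>Z1\<close> and one through \<open>Z2\<close>. For general objects
  this does not make \<open>X\<close> a summand of \<open>Z1\<close> or \<open>Z2\<close>; here it does, by the exchange property and indecomposability.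
\<close>

lemma indec_pinj_pure_in_biproduct:
  assumes X: "indec_pinj U C X" and s: "biproduct C Z1 Z2 s i1 i2 p1 p2" and m: "pure_mono U C X s m"
    and D1: "definable U C D1" "Z1 \<in> D1" and D2: "definable U C D2" "Z2 \<in> D2"
  shows "X \<in> D1 \<or> X \<in> D2"
proof -
  have XP: "pure_injective U C X" and XI: "indecomposable C X" using X unfolding indec_pinj_def by auto
  have h: "i1 \<in> Hom C Z1 s" "i2 \<in> Hom C Z2 s" "p1 \<in> Hom C s Z1" "p2 \<in> Hom C s Z2"
    "i1 \<cdot> p1 \<oplus>\<^sub>m i2 \<cdot> p2 = Ide C s" using s unfolding biproduct_def by blast+
  note mh = pure_monoD(1)[OF m]
  obtain t where t: "t \<in> Hom C s X" "t \<cdot> m = Ide C X" by (rule pure_injective_splits[OF XP m])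
  have q: "p1 \<cdot> m \<in> Hom C X Z1" "p2 \<cdot> m \<in> Hom C X Z2" "t \<cdot> i1 \<in> Hom C Z1 X" "t \<cdot> i2 \<in> Hom C Z2 X"
    using Cmp_closed mh h t by blast+
  define a where "a = (t \<cdot> i1) \<cdot> p1 \<cdot> m"
  define b where "b = (t \<cdot> i2) \<cdot> p2 \<cdot> m"
  have a: "a \<in> Hom C X X" "b \<in> Hom C X X" using Cmp_closed q unfolding a_def b_def by blast+
  have ip: "i1 \<cdot> p1 \<in> Hom C s s" "i2 \<cdot> p2 \<in> Hom C s s" using Cmp_closed h by blast+
  have "a = t \<cdot> (i1 \<cdot> p1) \<cdot> m" "b = t \<cdot> (i2 \<cdot> p2) \<cdot> m"
    unfolding a_def b_def
    using Cmp_assoc[OF q(1) h(1) t(1)] Cmp_assoc[OF q(2) h(2) t(1)] Cmp_assoc[OF mh h(3) h(1)]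
      Cmp_assoc[OF mh h(4) h(2)] by simp_all
  then have "a \<oplus>\<^sub>m b = t \<cdot> (i1 \<cdot> p1 \<oplus>\<^sub>m i2 \<cdot> p2) \<cdot> m"
    using Cmp_Add_right[OF Cmp_closed[OF mh ip(1)] Cmp_closed[OF mh ip(2)] t(1)] Cmp_Add_left[OF mh ip] by simp
  then have ab: "a \<oplus>\<^sub>m b = Ide C X" using h(5) Ide_left[OF mh] t(2) by simp
  obtain e d x y where e: "e \<in> Hom C X X" "d \<in> Hom C X X" "e \<oplus>\<^sub>m d = Ide C X" "e \<cdot> e = e"
    and x: "x \<in> Hom C X X" "e = x \<cdot> a" and y: "y \<in> Hom C X X" "d = y \<cdot> b"
    by (rule pure_injective_exchange[OF XP a ab])
  have "e = Ide C X \<or> d = Ide C X" by (rule indecomposable_idempotent[OF XI e(1,4,2,3)])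
  then show ?thesis
  proof
    assume "e = Ide C X"
    then have "(x \<cdot> t \<cdot> i1) \<cdot> p1 \<cdot> m = Ide C X" using x(2) Cmp_assoc[OF q(1,3) x(1)] unfolding a_def by simp
    then have "pure_mono U C X Z1 (p1 \<cdot> m)" using split_mono_pure[OF q(1) Cmp_closed[OF q(3) x(1)]] by blast
    then show ?thesis using definableD(4)[OF D1(1)] D1(2) by blast
  next
    assume "d = Ide C X"
    then have "(y \<cdot> t \<cdot> i2) \<cdot> p2 \<cdot> m = Ide C X" using y(2) Cmp_assoc[OF q(2,4) y(1)] unfolding b_def by simp
    then have "pure_mono U C X Z2 (p2 \<cdot> m)" using split_mono_pure[OF q(2) Cmp_closed[OF q(4) y(1)]] by blast
    then show ?thesis using definableD(4)[OF D2(1)] D2(2) by blast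
  qed
qed

text \<open>
  Let \<open>m1\<close> and \<open>m2\<close> be the maps supplied by \<open>weak_reflection\<close>. The map to \<open>Z1 \<oplus> Z2\<close> with these components is
  pure: if its composite with \<open>h\<close> factors through \<open>f\<close>, then so do \<open>m1 \<cdot> h\<close> and \<open>m2 \<cdot> h\<close>, hence all
  composites of \<open>h\<close> with maps to objects of \<open>D1\<close> or \<open>D2\<close>, and hence \<open>h\<close>.
\<close>

lemma indec_pinj_definable_join:
  assumes X: "indec_pinj U C X" and XJ: "X \<in> definable_join U C D1 D2"
    and D1: "definable U C D1" and D2: "definable U C D2"
  shows "X \<in> D1 \<or> X \<in> D2"
proof -
  have XO: "X \<in> Obj C" using XJ by (rule definable_join_Obj)
  obtain Z1 m1 where Z1: "Z1 \<in> D1" and m1: "m1 \<in> Hom C X Z1"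
    and u1: "\<And>A B f h Z' g. \<lbrakk>fp A; fp B; f \<in> Hom C A B; h \<in> Hom C A X; factors C f (m1 \<cdot> h); Z' \<in> D1; g \<in> Hom C X Z'\<rbrakk>
       \<Longrightarrow> factors C f (g \<cdot> h)"
    by (rule weak_reflection[OF D1 XO]) blast
  obtain Z2 m2 where Z2: "Z2 \<in> D2" and m2: "m2 \<in> Hom C X Z2"
    and u2: "\<And>A B f h Z' g. \<lbrakk>fp A; fp B; f \<in> Hom C A B; h \<in> Hom C A X; factors C f (m2 \<cdot> h); Z' \<in> D2; g \<in> Hom C X Z'\<rbrakk>
       \<Longrightarrow> factors C f (g \<cdot> h)"
    by (rule weak_reflection[OF D2 XO]) blast
  obtain s i1 i2 p1 p2 where s: "biproduct C Z1 Z2 s i1 i2 p1 p2"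
    using biproduct_exists Hom_Obj(2)[OF m1] Hom_Obj(2)[OF m2] by blast
  then have b: "i1 \<in> Hom C Z1 s" "i2 \<in> Hom C Z2 s" "p1 \<in> Hom C s Z1" "p2 \<in> Hom C s Z2"
    "p1 \<cdot> i1 = Ide C Z1" "p2 \<cdot> i2 = Ide C Z2" "p2 \<cdot> i1 = Nul C Z1 Z2" "p1 \<cdot> i2 = Nul C Z2 Z1"
    unfolding biproduct_def by blast+
  have im: "i1 \<cdot> m1 \<in> Hom C X s" "i2 \<cdot> m2 \<in> Hom C X s" using Cmp_closed b m1 m2 by blast+
  define m where "m = i1 \<cdot> m1 \<oplus>\<^sub>m i2 \<cdot> m2"
  have m: "m \<in> Hom C X s" using Add_closed[OF im] unfolding m_def .
  have pm1: "p1 \<cdot> m = m1"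
    using Cmp_Add_right[OF im b(3)] Cmp_assoc[OF m1 b(1,3)] Cmp_assoc[OF m2 b(2,3)] b(5,8) Ide_left[OF m1]
      Cmp_Nul_left[OF m2 Hom_Obj(2)[OF m1]] Add_Nul[OF m1] unfolding m_def by simp
  have pm2: "p2 \<cdot> m = m2"
    using Cmp_Add_right[OF im b(4)] Cmp_assoc[OF m1 b(1,4)] Cmp_assoc[OF m2 b(2,4)] b(6,7) Ide_left[OF m2]
      Cmp_Nul_left[OF m1 Hom_Obj(2)[OF m2]] Add_Nul[OF m2] unfolding m_def by simp
  have "pure_mono U C X s m"
  proof (rule pure_monoI[OF m])
    fix A B f h assume A: "fp A" and B: "fp B" and f: "f \<in> Hom C A B" and h: "h \<in> Hom C A X"
      and mh: "factors C f (m \<cdot> h)"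
    have "factors C f (p1 \<cdot> m \<cdot> h)" "factors C f (p2 \<cdot> m \<cdot> h)"
      using factors_Cmp[OF f Cmp_closed[OF h m] _ mh] b by blast+
    then have mh': "factors C f (m1 \<cdot> h)" "factors C f (m2 \<cdot> h)"
      using Cmp_assoc[OF h m] b pm1 pm2 by metis+
    show "factors C f h"
      by (rule definable_joinD[OF XJ A B f h])
        (use u1[OF A B f h mh'(1)] u2[OF A B f h mh'(2)] in blast)
  qed
  then show ?thesis by (rule indec_pinj_pure_in_biproduct[OF X s _ D1 Z1 D2 Z2])
qed

section \<open>Sets of indecomposable pure-injectives\<close>

text \<open>
  Membership in a definable subcategory does not depend on the representative of an isomorphism
  class, since isomorphisms are pure monomorphisms.
\<close>

lemma iso_class_pinj_in_iff:
  assumes X: "indec_pinj U C X" and D: "definable U C D"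
  shows "iso_class C X \<in> pinj_in U C D \<longleftrightarrow> X \<in> D"
proof
  assume "iso_class C X \<in> pinj_in U C D"
  then obtain Y where Y: "indec_pinj U C Y" "Y \<in> D" "iso_class C X = iso_class C Y"
    unfolding pinj_in_def by blast
  have YO: "Y \<in> Obj C" using Y(1) unfolding indec_pinj_def indecomposable_def by blast
  have "iso_arr C Y Y (Ide C Y)"
    using Ide_closed[OF YO] Ide_left[OF Ide_closed[OF YO]] unfolding iso_arr_def by blast
  then have "Y \<in> iso_class C X" using Y(3) YO unfolding iso_class_def by blast
  then obtain f where "iso_arr C X Y f" unfolding iso_class_def by blast
  then obtain g where "f \<in> Hom C X Y" "g \<in> Hom C Y X" "g \<cdot> f = Ide C X" unfolding iso_arr_def by blast
  then have "pure_mono U C X Y f" by (rule split_mono_pure)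
  then show "X \<in> D" using definableD(4)[OF D] Y(2) by blast
qed (use X in \<open>auto simp: pinj_in_def\<close>)

lemma pinj_in_subset: "pinj_in U C D \<subseteq> pinj U C"
  unfolding pinj_in_def pinj_def by blast

lemma pinj_in_definable_join:
  assumes "definable U C D1" "definable U C D2"
  shows "pinj_in U C (definable_join U C D1 D2) = pinj_in U C D1 \<union> pinj_in U C D2"
  using indec_pinj_definable_join assms definable_join_upper[OF assms] unfolding pinj_in_def by blast

lemma definable_Inter:
  assumes "\<D> \<noteq> {}" "\<And>D. D \<in> \<D> \<Longrightarrow> definable U C D"
  shows "definable U C (\<Inter>\<D>)"
  unfolding definable_def
proof (intro conjI allI impI)
  show "\<Inter>\<D> \<subseteq> Obj C" using assms definableD(1) by blast
next
  fix I X P p assume *: "I \<subseteq> U \<and> I \<prec> U \<and> (\<forall>i\<in>I. X i \<in> \<Inter>\<D>) \<and> product_cone C I X P p"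
  show "P \<in> \<Inter>\<D>"
    by (rule InterI, rule definableD(2)[OF assms(2)]) (use * in auto)
next
  fix I r X \<phi> L l assume *: "directed_index U I r \<and> direct_system C I r X \<phi> \<and> (\<forall>i\<in>I. X i \<in> \<Inter>\<D>) \<and>
    direct_limit C I r X \<phi> L l"
  show "L \<in> \<Inter>\<D>"
    by (rule InterI, rule definableD(3)[OF assms(2)]) (use * in auto)
next
  fix X Y m assume *: "pure_mono U C X Y m \<and> Y \<in> \<Inter>\<D>"
  show "X \<in> \<Inter>\<D>"
    by (rule InterI, rule definableD(4)[OF assms(2)]) (use * in auto)
qed

lemma pinj_in_Inter:
  assumes "\<D> \<noteq> {}" "\<And>D. D \<in> \<D> \<Longrightarrow> definable U C D"
  shows "pinj_in U C (\<Inter>\<D>) = (\<Inter>D\<in>\<D>. pinj_in U C D)"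
proof (intro equalityI subsetI)
  fix c assume "c \<in> pinj_in U C (\<Inter>\<D>)"
  then show "c \<in> (\<Inter>D\<in>\<D>. pinj_in U C D)" unfolding pinj_in_def by blast
next
  fix c assume c: "c \<in> (\<Inter>D\<in>\<D>. pinj_in U C D)"
  then obtain X where X: "indec_pinj U C X" "c = iso_class C X" using assms(1) unfolding pinj_in_def by blast
  then have "X \<in> D" if "D \<in> \<D>" for D using iso_class_pinj_in_iff[OF X(1) assms(2)[OF that]] c that by blast
  then show "c \<in> pinj_in U C (\<Inter>\<D>)" using X unfolding pinj_in_def by blast
qed

lemma definable_Obj: "definable U C (Obj C)"
  unfolding definable_def product_cone_def direct_limit_def cocone_def pure_mono_def by blast

lemma definable_zero: "definable U C {z. zero_object C z}"
  unfolding definable_def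
proof (intro conjI allI impI)
  show "{z. zero_object C z} \<subseteq> Obj C" unfolding zero_object_def by blast
next
  fix I X P p assume *: "I \<subseteq> U \<and> I \<prec> U \<and> (\<forall>i\<in>I. X i \<in> {z. zero_object C z}) \<and> product_cone C I X P p"
  then have P: "P \<in> Obj C" and p: "\<forall>i\<in>I. p i \<in> Hom C P (X i)" unfolding product_cone_def by blast+
  have "\<exists>!u. u \<in> Hom C P P \<and> (\<forall>i\<in>I. p i \<cdot> u = p i)"
    by (rule product_cone_tuple[of C I X P p P p]) (use * P p in auto)
  moreover have "p i \<cdot> u = p i" if "u \<in> Hom C P P" "i \<in> I" for u i
  proof -
    have "\<exists>!f. f \<in> Hom C P (X i)" using * P that(2) unfolding zero_object_def by auto
    moreover have "p i \<cdot> u \<in> Hom C P (X i)" "p i \<in> Hom C P (X i)" using p that Cmp_closed by blast+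
    ultimately show ?thesis by blast
  qed
  ultimately have "Ide C P = Nul C P P" using Ide_closed[OF P] Nul_closed[OF P P] by blast
  then show "P \<in> {z. zero_object C z}" using zero_object_iff[OF P] by simp
next
  fix I r X \<phi> L l assume *: "directed_index U I r \<and> direct_system C I r X \<phi> \<and>
    (\<forall>i\<in>I. X i \<in> {z. zero_object C z}) \<and> direct_limit C I r X \<phi> L l"
  then have L: "direct_limit C I r X \<phi> L l" and sys: "direct_system C I r X \<phi>"
    and I: "directed_index U I r" by blast+
  note co = cocone_component[OF direct_limit_cocone[OF L]]
  have "Ide C L = Nul C L L"
  proof (rule direct_limit_eqI[OF L sys directed_indexD(4)[OF I] Ide_closed[OF co(1)] Nul_closed[OF co(1,1)]])
    fix i assume i: "i \<in> I"
    have "\<exists>!f. f \<in> Hom C (X i) L" using * i co(1) unfolding zero_object_def by auto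
    then show "Ide C L \<cdot> l i = Nul C L L \<cdot> l i"
      using Cmp_closed[OF co(2)[OF i]] Ide_closed[OF co(1)] Nul_closed[OF co(1,1)] by blast
  qed
  then show "L \<in> {z. zero_object C z}" using zero_object_iff[OF co(1)] by simp
next
  fix X Y m assume *: "pure_mono U C X Y m \<and> Y \<in> {z. zero_object C z}"
  then have m: "mono_arr C X Y m" and X: "X \<in> Obj C" and Y: "zero_object C Y" unfolding pure_mono_def by auto
  have "m \<in> Hom C X Y" using m unfolding mono_arr_def by blast
  moreover have "\<exists>!f. f \<in> Hom C X Y" using Y X unfolding zero_object_def by blast
  ultimately have "m \<cdot> Ide C X = m \<cdot> Nul C X X" using Cmp_closed Ide_closed[OF X] Nul_closed[OF X X] by blast
  then have "Ide C X = Nul C X X" using m X Ide_closed[OF X] Nul_closed[OF X X] unfolding mono_arr_def by blast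
  then show "X \<in> {z. zero_object C z}" using zero_object_iff[OF X] by simp
qed

lemma pinj_in_zero: "pinj_in U C {z. zero_object C z} = {}"
  unfolding pinj_in_def indec_pinj_def indecomposable_def by blast

end

section \<open>Internal homs\<close>

context closed_symmetric_monoidal_category
begin

definition uncurry where
  "uncurry a b k = Ev C a b \<cdot> (k \<otimes>\<^sub>a Ide C a)"

lemma uncurry_closed:
  assumes "k \<in> Hom C x (IHom C a b)" "a \<in> Obj C" "b \<in> Obj C"
  shows "uncurry a b k \<in> Hom C (x \<otimes>\<^sub>o a) b"
  unfolding uncurry_def
  using Cmp_closed[OF Tar_closed[OF assms(1) Ide_closed[OF assms(2)]] Ev_closed[OF assms(2,3)]] .

lemma uncurry_inj:
  assumes "k \<in> Hom C x (IHom C a b)" "k' \<in> Hom C x (IHom C a b)" "a \<in> Obj C" "b \<in> Obj C"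
    and "uncurry a b k = uncurry a b k'"
  shows "k = k'"
proof -
  have "\<exists>!g. g \<in> Hom C x (IHom C a b) \<and> Ev C a b \<cdot> (g \<otimes>\<^sub>a Ide C a) = uncurry a b k"
    by (rule Ev_universal[OF assms(3,4) Hom_Obj(1)[OF assms(1)] uncurry_closed[OF assms(1,3,4)]])
  then show ?thesis using assms unfolding uncurry_def by metis
qed

lemma uncurry_surj:
  assumes "f \<in> Hom C (x \<otimes>\<^sub>o a) b" "x \<in> Obj C" "a \<in> Obj C" "b \<in> Obj C"
  obtains k where "k \<in> Hom C x (IHom C a b)" "uncurry a b k = f"
  using Ev_universal[OF assms(3,4,2,1)] unfolding uncurry_def by blast

lemma uncurry_Cmp:
  assumes f: "f \<in> Hom C x y" and k: "k \<in> Hom C y (IHom C a b)" and a: "a \<in> Obj C" and b: "b \<in> Obj C"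
  shows "uncurry a b (k \<cdot> f) = uncurry a b k \<cdot> (f \<otimes>\<^sub>a Ide C a)"
proof -
  note i = Ide_closed[OF a]
  have "(k \<cdot> f) \<otimes>\<^sub>a Ide C a = (k \<otimes>\<^sub>a Ide C a) \<cdot> (f \<otimes>\<^sub>a Ide C a)"
    using Tar_Cmp[OF f k i i] Ide_left[OF i] by simp
  then show ?thesis
    unfolding uncurry_def using Cmp_assoc[OF Tar_closed[OF f i] Tar_closed[OF k i] Ev_closed[OF a b]] by simp
qed

lemma factors_uncurry:
  assumes f: "f \<in> Hom C x y" and h: "h \<in> Hom C x (IHom C a b)" and a: "a \<in> Obj C" and b: "b \<in> Obj C"
  shows "factors C (f \<otimes>\<^sub>a Ide C a) (uncurry a b h) \<longleftrightarrow> factors C f h"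
proof
  assume "factors C (f \<otimes>\<^sub>a Ide C a) (uncurry a b h)"
  then obtain k where k: "k \<in> Hom C (y \<otimes>\<^sub>o a) b" "k \<cdot> (f \<otimes>\<^sub>a Ide C a) = uncurry a b h"
    using HomD(3)[OF Tar_closed[OF f Ide_closed[OF a]]] HomD(3)[OF uncurry_closed[OF h a b]]
    unfolding factors_def by auto
  obtain k' where k': "k' \<in> Hom C y (IHom C a b)" "uncurry a b k' = k"
    by (rule uncurry_surj[OF k(1) Hom_Obj(2)[OF f] a b])
  have "k' \<cdot> f = h"
    by (rule uncurry_inj[OF Cmp_closed[OF f k'(1)] h a b]) (use uncurry_Cmp[OF f k'(1) a b] k'(2) k(2) in simp)
  then show "factors C f h" using k'(1) HomD(3)[OF f] HomD(3)[OF h] unfolding factors_def by auto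
next
  assume "factors C f h"
  then obtain k where k: "k \<in> Hom C y (IHom C a b)" "k \<cdot> f = h"
    using HomD(3)[OF f] HomD(3)[OF h] unfolding factors_def by auto
  then show "factors C (f \<otimes>\<^sub>a Ide C a) (uncurry a b h)"
    using uncurry_Cmp[OF f k(1) a b] uncurry_closed[OF k(1) a b]
      HomD(3)[OF Tar_closed[OF f Ide_closed[OF a]]] HomD(3)[OF uncurry_closed[OF h a b]]
    unfolding factors_def by auto
qed

lemma IHom_map:
  assumes g: "g \<in> Hom C b c" and a: "a \<in> Obj C"
  obtains t where "t \<in> Hom C (IHom C a b) (IHom C a c)"
    "\<And>x h. h \<in> Hom C x (IHom C a b) \<Longrightarrow> uncurry a c (t \<cdot> h) = g \<cdot> uncurry a b h"
proof -
  note bc = Hom_Obj[OF g]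
  note ev = Ev_closed[OF a bc(1)]
  obtain t where t: "t \<in> Hom C (IHom C a b) (IHom C a c)" "uncurry a c t = g \<cdot> Ev C a b"
    by (rule uncurry_surj[OF Cmp_closed[OF ev g] IHom_closed[OF a bc(1)] a bc(2)])
  have "uncurry a c (t \<cdot> h) = g \<cdot> uncurry a b h" if h: "h \<in> Hom C x (IHom C a b)" for x h
    using uncurry_Cmp[OF h t(1) a bc(2)] t(2) Cmp_assoc[OF Tar_closed[OF h Ide_closed[OF a]] ev g]
    unfolding uncurry_def by simp
  then show thesis using that t(1) by blast
qed

end

locale finitely_accessible_monoidal_category =
  additive_closed_symmetric_monoidal_category C + finitely_accessible_category_with_products C U
  for C :: "('o, 'm, 'z) csm_cat_scheme" (structure) and U :: "'u set" +
  assumes fp_monoidal: "fp_monoidal_subcategory U C"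
begin

text \<open>
  A map \<open>g : X \<rightarrow> Z\<close> that detects the transpose of \<open>h : B \<rightarrow> hom(A, X)\<close> induces \<open>hom(A, X) \<rightarrow> hom(A, Z)\<close>, and
  this map detects \<open>h\<close>; its target stays in \<open>D1\<close> or \<open>D2\<close>.
\<close>

lemma fp_hom_closed_definable_join:
  assumes D1: "fp_hom_closed U C D1" and D2: "fp_hom_closed U C D2"
  shows "fp_hom_closed U C (definable_join U C D1 D2)"
  unfolding fp_hom_closed_def
proof (intro allI impI, elim conjE)
  fix A X assume A: "fp A" and X: "X \<in> definable_join U C D1 D2"
  note AO = fp_Obj[OF A] and XO = definable_join_Obj[OF X]
  show "IHom C A X \<in> definable_join U C D1 D2"
  proof (rule definable_joinI[OF IHom_closed[OF AO XO]])
    fix B B' f h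
    assume B: "fp B" and B': "fp B'" and f: "f \<in> Hom C B B'" and h: "h \<in> Hom C B (IHom C A X)"
      and det: "\<And>Z g. Z \<in> D1 \<union> D2 \<Longrightarrow> g \<in> Hom C (IHom C A X) Z \<Longrightarrow> factors C f (g \<cdot> h)"
    have tensor: "fp (B \<otimes>\<^sub>o A)" "fp (B' \<otimes>\<^sub>o A)"
      using fp_monoidal A B B' unfolding fp_monoidal_subcategory_def by blast+
    have "factors C (f \<otimes>\<^sub>a Ide C A) (uncurry A X h)"
    proof (rule definable_joinD[OF X tensor Tar_closed[OF f Ide_closed[OF AO]] uncurry_closed[OF h AO XO]])
      fix Z g assume Z: "Z \<in> D1 \<union> D2" and g: "g \<in> Hom C X Z"
      obtain t where t: "t \<in> Hom C (IHom C A X) (IHom C A Z)"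
        "\<And>x h. h \<in> Hom C x (IHom C A X) \<Longrightarrow> uncurry A Z (t \<cdot> h) = g \<cdot> uncurry A X h"
        by (rule IHom_map[OF g AO]) blast
      have "IHom C A Z \<in> D1 \<union> D2" using Z A D1 D2 unfolding fp_hom_closed_def by blast
      then have "factors C f (t \<cdot> h)" using det t(1) by blast
      then show "factors C (f \<otimes>\<^sub>a Ide C A) (g \<cdot> uncurry A X h)"
        using factors_uncurry[OF f Cmp_closed[OF h t(1)] AO Hom_Obj(2)[OF g]] t(2)[OF h] by simp
    qed
    then show "factors C f h" using factors_uncurry[OF f h AO XO] by simp
  qed
qed

lemma fp_hom_closed_Obj: "fp_hom_closed U C (Obj C)"
  unfolding fp_hom_closed_def using IHom_closed fp_Obj by blast

lemma fp_hom_closed_zero: "fp_hom_closed U C {z. zero_object C z}"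
  unfolding fp_hom_closed_def
proof (intro allI impI, elim conjE, simp)
  fix A z assume A: "fp A" and z: "zero_object C z"
  note AO = fp_Obj[OF A]
  have zO: "z \<in> Obj C" using z unfolding zero_object_def by blast
  note H = IHom_closed[OF AO zO]
  have "\<exists>!f. f \<in> Hom C (IHom C A z \<otimes>\<^sub>o A) z" using z Tob_closed[OF H AO] unfolding zero_object_def by blast
  then have "uncurry A z (Ide C (IHom C A z)) = uncurry A z (Nul C (IHom C A z) (IHom C A z))"
    using uncurry_closed[OF _ AO zO] Ide_closed[OF H] Nul_closed[OF H H] by blast
  then have "Ide C (IHom C A z) = Nul C (IHom C A z) (IHom C A z)"
    by (rule uncurry_inj[OF Ide_closed[OF H] Nul_closed[OF H H] AO zO])
  then show "zero_object C (IHom C A z)" using zero_object_iff[OF H] by simp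
qed

lemma fp_hom_closed_Inter:
  assumes "\<And>D. D \<in> \<D> \<Longrightarrow> fp_hom_closed U C D"
  shows "fp_hom_closed U C (\<Inter>\<D>)"
  using assms unfolding fp_hom_closed_def by blast

end

section \<open>The topology\<close>

lemma topology_from_closed_sets:
  fixes \<K> :: "'a set set"
  assumes sub: "\<And>F. F \<in> \<K> \<Longrightarrow> F \<subseteq> S" and empty: "{} \<in> \<K>" and whole: "S \<in> \<K>"
    and Un: "\<And>E F. E \<in> \<K> \<Longrightarrow> F \<in> \<K> \<Longrightarrow> E \<union> F \<in> \<K>"
    and Inter: "\<And>\<F>. \<F> \<noteq> {} \<Longrightarrow> \<F> \<subseteq> \<K> \<Longrightarrow> \<Inter>\<F> \<in> \<K>"
  shows "\<exists>T. topspace T = S \<and> (\<forall>F. closedin T F \<longleftrightarrow> F \<in> \<K>)"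
proof -
  define opn where "opn V \<longleftrightarrow> V \<subseteq> S \<and> S - V \<in> \<K>" for V
  have "istopology opn" unfolding istopology_def
  proof (intro conjI allI impI)
    fix V W assume "opn V" "opn W"
    moreover have "S - V \<inter> W = (S - V) \<union> (S - W)" by blast
    ultimately show "opn (V \<inter> W)" using Un unfolding opn_def by auto
  next
    fix \<V> assume V: "\<forall>V\<in>\<V>. opn V"
    show "opn (\<Union>\<V>)"
    proof (cases "\<V> = {}")
      case True
      then show ?thesis using whole unfolding opn_def by simp
    next
      case False
      then have "S - \<Union>\<V> = \<Inter>((\<lambda>V. S - V) ` \<V>)" by blast
      moreover have "\<Inter>((\<lambda>V. S - V) ` \<V>) \<in> \<K>"
        by (rule Inter) (use False V in \<open>auto simp: opn_def\<close>)
      ultimately show ?thesis using V unfolding opn_def by auto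
    qed
  qed
  then have opn: "openin (topology opn) = opn" by (rule topology_inverse')
  have "opn S" using empty unfolding opn_def by simp
  moreover have "V \<subseteq> S" if "opn V" for V using that unfolding opn_def by blast
  ultimately have top: "topspace (topology opn) = S" unfolding topspace_def opn by blast
  have "closedin (topology opn) F \<longleftrightarrow> F \<in> \<K>" for F
  proof -
    have "S - (S - F) = F" if "F \<subseteq> S" using that by blast
    then show ?thesis using sub unfolding closedin_def top opn opn_def by auto
  qed
  then show ?thesis using top by blast
qed

theorem theorem4p1:
  fixes U :: "'u set" and C :: "('o, 'm) csm_cat"
  assumes "universe U"
    and "additive_closed_symmetric_monoidal_category C"
    and "finitely_accessible U C"
    and "has_products U C"
    and "fp_monoidal_subcategory U C"
  shows "\<exists>T. topspace T = pinj U C \<and>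
           (\<forall>F. closedin T F \<longleftrightarrow>
              (\<exists>D. definable U C D \<and> fp_hom_closed U C D \<and> F = pinj_in U C D))"
proof -
  interpret additive_closed_symmetric_monoidal_category C by fact
  interpret finitely_accessible_monoidal_category C U
    by unfold_locales (use assms in auto)
  define \<K> where "\<K> = {pinj_in U C D | D. definable U C D \<and> fp_hom_closed U C D}"
  have "\<exists>T. topspace T = pinj U C \<and> (\<forall>F. closedin T F \<longleftrightarrow> F \<in> \<K>)"
  proof (rule topology_from_closed_sets)
    show "F \<subseteq> pinj U C" if "F \<in> \<K>" for F using that pinj_in_subset unfolding \<K>_def by blast
    show "{} \<in> \<K>" using definable_zero fp_hom_closed_zero pinj_in_zero unfolding \<K>_def by blast
    have "pinj U C = pinj_in U C (Obj C)"
      unfolding pinj_def pinj_in_def indec_pinj_def indecomposable_def by blast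
    then show "pinj U C \<in> \<K>" using definable_Obj fp_hom_closed_Obj unfolding \<K>_def by blast
  next
    fix E F assume "E \<in> \<K>" "F \<in> \<K>"
    then obtain D1 D2 where D: "definable U C D1" "fp_hom_closed U C D1" "E = pinj_in U C D1"
      "definable U C D2" "fp_hom_closed U C D2" "F = pinj_in U C D2" unfolding \<K>_def by blast
    then show "E \<union> F \<in> \<K>"
      using definable_definable_join[OF D(1,4)] fp_hom_closed_definable_join[OF D(2,5)]
        pinj_in_definable_join[OF D(1,4)] unfolding \<K>_def by blast
  next
    fix \<F> assume \<F>: "\<F> \<noteq> {}" "\<F> \<subseteq> \<K>"
    define \<D> where "\<D> = {D. definable U C D \<and> fp_hom_closed U C D \<and> pinj_in U C D \<in> \<F>}"
    have D: "\<D> \<noteq> {}" using \<F> unfolding \<D>_def \<K>_def by blast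
    have defn: "definable U C D" if "D \<in> \<D>" for D using that unfolding \<D>_def by blast
    have "\<F> = pinj_in U C ` \<D>" using \<F> unfolding \<D>_def \<K>_def by blast
    then have "\<Inter>\<F> = pinj_in U C (\<Inter>\<D>)" using pinj_in_Inter[OF D defn] by simp
    moreover have "definable U C (\<Inter>\<D>)" by (rule definable_Inter[OF D defn])
    moreover have "fp_hom_closed U C (\<Inter>\<D>)"
      by (rule fp_hom_closed_Inter) (simp add: \<D>_def)
    ultimately show "\<Inter>\<F> \<in> \<K>" unfolding \<K>_def by blast
  qed
  moreover have "F \<in> \<K> \<longleftrightarrow> (\<exists>D. definable U C D \<and> fp_hom_closed U C D \<and> F = pinj_in U C D)" for F
    unfolding \<K>_def by blast
  ultimately show ?thesis by simp
qed

end
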